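(* Let $t\ge1$ be an integer and $g=2t$. Let $\omega\in\mathcal{SC}_{(g)}$ be a self-conjugate $g$-core, let $\mathbf{v}\in\mathbb{Z}^t$ be its $V_{g,t}$-coding, and set $r_i=v_i-g/2+1/2$ for $1\le i\le t$. Then $$|\omega| = \frac{1}{g}\sum_{i=1}^{t} r_i^2-\frac{g^2-1}{24}.$$ Moreover, setting $\alpha_i(\omega)=\#\{s\in\omega\mid h_s=g-i,\ \varepsilon_s=1\}$, for any field $F$ and any function $\tau:\mathbb{Z}\to F^{\times}$, $$\prod_{s\in\omega}\frac{\tau(h_s-\varepsilon_s g)}{\tau(h_s)}=\prod_{i=1}^{g-1}\left(\frac{\tau(-i)}{\tau(i)}\right)^{\alpha_i(\omega)}\prod_{1\le i<j\le t} \frac{\tau(r_i-r_j)}{\tau(j-i)}\, \frac{\tau(r_i+r_j)}{\tau(g+1-i-j)}.$$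
   Context: For a partition $\lambda$, $h_s$ is the hook length of a box $s$, and $\varepsilon_s=-1$ if $s$ is strictly below the main diagonal of the Ferrers diagram (English convention), $\varepsilon_s=1$ otherwise. A $g$-core is a partition with no hook length divisible by $g$. $\mathcal{SC}$ is the set of self-conjugate partitions and $\mathcal{SC}_{(g)}$ the set of $g$-cores in it (including the empty partition). Word of a partition: $\psi(\lambda)=(c_k)_{k\in\mathbb{Z}}\in\{0,1\}^{\mathbb{Z}}$ encodes the border of the Ferrers diagram read from South-West to North-East ($0$ vertical step, $1$ horizontal step), indexed so that $\#\{k\le -1: c_k=1\}=\#\{k\ge 0: c_k=0\}$; equivalently $c_k=0$ iff $k=\lambda_i-i$ for some $i\ge1$ (with $\lambda_i=0$ beyond the length). $V_{g,t}$-coding: for $i\in\{0,\dots,g-1\}$ let $\beta_i=\max\{(k+1)g+i\mid k\in\mathbb{Z},\ c_{kg+i}=0\}$; the $V_{g,t}$-coding is $\mathbf{v}=(v_1>\dots>v_t)$, the $t$ largest of the distinct integers $\beta_0,\dots,\beta_{g-1}$ in decreasing order. (Here the $r_i$ are half-integers, and $r_i\pm r_j$ are integers.) *)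

theory Defs
  imports Complex_Main
begin

text \<open>A partition is the weakly decreasing list of its (positive) parts. Rows and columns of
  Ferrers diagrams are numbered from 1, and boxes are pairs (row, column).\<close>

definition is_partition :: "nat list \<Rightarrow> bool" where
  "is_partition l \<longleftrightarrow> sorted_wrt (\<ge>) l \<and> (\<forall>x\<in>set l. 0 < x)"

text \<open>The \<open>i\<close>-th part, for \<open>i \<ge> 1\<close>, with value 0 beyond the length.\<close>
definition part :: "nat list \<Rightarrow> nat \<Rightarrow> nat" where
  "part l i = (if 1 \<le> i \<and> i \<le> length l then l ! (i - 1) else 0)"

definition diagram :: "nat list \<Rightarrow> (nat \<times> nat) set" where
  "diagram l = {(i, j). 1 \<le> i \<and> i \<le> length l \<and> 1 \<le> j \<and> j \<le> part l i}"

definition conjugate :: "nat list \<Rightarrow> nat list" where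
  "conjugate l = map (\<lambda>j. card {i. (i, j) \<in> diagram l}) [1..<part l 1 + 1]"

definition hook :: "nat list \<Rightarrow> nat \<times> nat \<Rightarrow> nat" where
  "hook l s = card {(i, j). (i, j) \<in> diagram l \<and>
      ((i = fst s \<and> snd s \<le> j) \<or> (j = snd s \<and> fst s \<le> i))}"

definition eps :: "nat \<times> nat \<Rightarrow> int" where
  "eps s = (if snd s < fst s then -1 else 1)"

definition SC :: "nat list set" where
  "SC = {l. is_partition l \<and> conjugate l = l}"

definition is_core :: "nat \<Rightarrow> nat list \<Rightarrow> bool" where
  "is_core g l \<longleftrightarrow> is_partition l \<and> (\<forall>s\<in>diagram l. \<not> g dvd hook l s)"

definition SC_core :: "nat \<Rightarrow> nat list set" where
  "SC_core g = {l \<in> SC. is_core g l}"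

text \<open>A step of the border, read from South-West to North-East, that starts \<open>x\<close> units to the right
  of and \<open>y\<close> units below the top left corner has index \<open>x - y\<close>. The vertical step that ends
  row \<open>i \<ge> 1\<close> starts at \<open>x = \<lambda>\<^sub>i\<close>, \<open>y = i\<close>, so the letters 0 sit exactly at the indices
  \<open>\<lambda>\<^sub>i - i\<close>. The lemma \<open>word_balanced\<close> shows that this is the normalisation in which
  there are as many 1s at negative indices as 0s at nonnegative indices.\<close>

definition word :: "nat list \<Rightarrow> int \<Rightarrow> nat" where
  "word l k = (if \<exists>i\<ge>1. k = int (part l i) - int i then 0 else 1)"

lemma part_antimono:
  assumes "is_partition l" "1 \<le> i" "i \<le> j"
  shows "part l j \<le> part l i"
  using assms unfolding is_partition_def part_def sorted_wrt_iff_nth_less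
  by (cases "i = j") auto

lemma word_balanced:
  assumes "is_partition l"
  shows "finite {k. k \<le> -1 \<and> word l k = 1}" "finite {k. 0 \<le> k \<and> word l k = 0}"
    "card {k. k \<le> -1 \<and> word l k = 1} = card {k. 0 \<le> k \<and> word l k = 0}"
proof -
  define N where "N = length l"
  define f where "f i = int (part l i) - int i" for i
  have beyond: "f i = - int i" if "i > N" for i
    using that by (simp add: f_def part_def N_def)
  have zero_iff: "word l k = 0 \<longleftrightarrow> (\<exists>i\<ge>1. k = f i)" for k
    by (auto simp: word_def f_def)
  have one_iff: "word l k = 1 \<longleftrightarrow> word l k \<noteq> 0" for k
    by (auto simp: word_def)
  have low: "word l k = 0" if "k < - int N" for k
    unfolding zero_iff using that beyond[of "nat (-k)"] by (intro exI[of _ "nat (-k)"]) auto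
  have less: "f j < f i" if "1 \<le> i" "i < j" for i j
    using part_antimono[OF assms that(1), of j] that by (simp add: f_def)
  have inj: "inj_on f {1..N}"
    by (rule inj_onI) (metis atLeastAtMost_iff less less_irrefl nat_neq_iff)
  have zeros: "{k. - int N \<le> k \<and> word l k = 0} = f ` {1..N}" (is "?Z = _")
  proof (intro equalityI subsetI)
    fix k assume "k \<in> ?Z"
    then obtain i where i: "i \<ge> 1" "k = f i" "- int N \<le> f i" by (auto simp: zero_iff)
    with beyond[of i] have "i \<le> N" by (cases "i \<le> N") auto
    with i show "k \<in> f ` {1..N}" by auto
  next
    fix k assume "k \<in> f ` {1..N}"
    then show "k \<in> ?Z" by (auto simp: zero_iff) (auto simp: f_def)
  qed
  let ?P = "{k. 0 \<le> k \<and> word l k = 0}"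
  let ?M = "{k. - int N \<le> k \<and> k \<le> -1 \<and> word l k = 0}"
  let ?O = "{k. k \<le> -1 \<and> word l k = 1}"
  have "?Z = ?P \<union> ?M" by auto
  moreover have finZ: "finite ?Z" and cardZ: "card ?Z = N"
    unfolding zeros using inj by (auto simp: card_image)
  ultimately have finP: "finite ?P" and finM: "finite ?M" and PM: "card (?P \<union> ?M) = N"
    by auto
  have "?P \<inter> ?M = {}" by auto
  with finP finM have "card (?P \<union> ?M) = card ?P + card ?M"
    by (rule card_Un_disjoint)
  with PM have PM: "card ?P + card ?M = N" by simp
  have I: "{- int N..-1} = ?O \<union> ?M"
  proof (intro set_eqI)
    fix k show "k \<in> {- int N..-1} \<longleftrightarrow> k \<in> ?O \<union> ?M"
      using low[of k] one_iff[of k] by (cases "k < - int N") auto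
  qed
  have finO: "finite ?O"
    by (rule finite_subset[OF _ finite_atLeastAtMost_int[of "- int N" "-1"]]) (simp only: I Un_upper1)
  have "card ?O + card ?M = N"
  proof -
    have "?O \<inter> ?M = {}" by auto
    with finO finM have "card (?O \<union> ?M) = card ?O + card ?M"
      by (rule card_Un_disjoint)
    then show ?thesis unfolding I[symmetric] by simp
  qed
  with PM show "card ?O = card ?P" by simp
  show "finite ?O" "finite ?P" by (fact finO finP)+
qed

text \<open>For a partition and \<open>g \<ge> 1\<close>, the set of integers maximised here is nonempty and bounded above.\<close>
definition beta :: "nat \<Rightarrow> nat list \<Rightarrow> nat \<Rightarrow> int" where
  "beta g l i = (GREATEST b. \<exists>k::int. b = (k + 1) * int g + int i \<and> word l (k * int g + int i) = 0)"

definition V_coding :: "nat \<Rightarrow> nat \<Rightarrow> nat list \<Rightarrow> int list" where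
  "V_coding g t l = take t (rev (sorted_list_of_set (beta g l ` {0..<g})))"

definition alpha :: "nat \<Rightarrow> nat list \<Rightarrow> nat \<Rightarrow> nat" where
  "alpha g l i = card {s \<in> diagram l. int (hook l s) = int g - int i \<and> eps s = 1}"

text \<open>Sums and differences of half-integers are integers, so taking \<open>floor\<close> of them merely
  converts between types.\<close>
lemma floor_half_integers:
  fixes a b :: int and g :: nat
  defines "x \<equiv> of_int a - of_nat g / 2 + 1/2 :: rat" and "y \<equiv> of_int b - of_nat g / 2 + 1/2 :: rat"
  shows "of_int \<lfloor>x - y\<rfloor> = x - y" "of_int \<lfloor>x + y\<rfloor> = x + y"
proof -
  have "x - y = of_int (a - b)" "x + y = of_int (a + b - int g + 1)"
    by (simp_all add: x_def y_def)
  then show "of_int \<lfloor>x - y\<rfloor> = x - y" "of_int \<lfloor>x + y\<rfloor> = x + y"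
    by (simp_all only: floor_of_int)
qed

end

theory Submission
  imports Defs
begin

text \<open>Encode a self-conjugate \<open>g\<close>-core by its beads \<open>X = {\<lambda>\<^sub>i - i}\<close>: self-conjugacy means
  \<open>k \<in> X \<longleftrightarrow> -1 - k \<notin> X\<close>, the core property means \<open>X - g \<subseteq> X\<close>, and boxes become pairs of beads with
  \<open>x + y + 1 > 0\<close>. Induct on the number of nonnegative beads by removing the first row and column.
  The size drops by the hook length \<open>2 r\<^sub>1 - g\<close> of the corner, which is \<open>(r\<^sub>1\<^sup>2 - (r\<^sub>1 - g)\<^sup>2) / g\<close>.
  The product over the removed boxes telescopes along residue classes modulo \<open>g\<close> to
  \<open>\<tau>(r\<^sub>1 + \<rho>) / \<tau>(r\<^sub>1 + \<rho> - g)\<close> over the \<open>\<rho> \<in> {\<plusminus>r\<^sub>2, \<dots>, \<plusminus>r\<^sub>t}\<close> with \<open>r\<^sub>1 + \<rho> > g\<close>, times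
  \<open>\<tau>(s - g) / \<tau>(s)\<close> over the first-row hook lengths \<open>s < g\<close>. The latter and the \<open>\<rho>\<close> with
  \<open>r\<^sub>1 + \<rho> < g\<close> together use every residue \<open>1, \<dots>, g - 1\<close> once, and the product of
  \<open>\<tau>(s) / \<tau>(g - s)\<close> over all of them is 1.\<close>

subsection \<open>Symmetric cores of beads\<close>

text \<open>Together with the reflection, finiteness forces every sufficiently negative integer to
  be a bead, as the border of a partition requires.\<close>

definition sym_core :: "nat \<Rightarrow> int set \<Rightarrow> bool" where
  "sym_core t X \<longleftrightarrow> finite {x \<in> X. 0 \<le> x} \<and> (\<forall>k. k \<in> X \<longleftrightarrow> -1 - k \<notin> X)
    \<and> (\<forall>k\<in>X. k - 2 * int t \<in> X)"

text \<open>Under \<open>(i, j) \<mapsto> (\<lambda>\<^sub>i - i, \<lambda>\<^sub>j - j)\<close> these are the boxes of a self-conjugate partition, with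
  hook length \<open>x + y + 1\<close>; the sign is \<open>-1\<close> iff \<open>x < y\<close>.\<close>
definition pos_pairs :: "int set \<Rightarrow> (int \<times> int) set" where
  "pos_pairs X = {(x, y). x \<in> X \<and> y \<in> X \<and> 0 < x + y + 1}"

text \<open>The numbers \<open>r\<^sub>i - 1/2\<close>. The full set of \<open>g\<close> runner tops is this set together with its image
  under \<open>b \<mapsto> -1 - b\<close>, i.e. it consists of the half-integers \<open>\<plusminus>r\<^sub>i\<close> shifted by \<open>-1/2\<close>.\<close>
definition tops :: "nat \<Rightarrow> int set \<Rightarrow> int set" where
  "tops t X = {b. 0 \<le> b \<and> b - int t \<in> X \<and> b + int t \<notin> X}"

text \<open>If \<open>S\<close> consists of the numbers \<open>r\<^sub>i - 1/2\<close>, then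
  \<open>a - b\<close> and \<open>a + b + 1\<close> are \<open>r\<^sub>i - r\<^sub>j\<close> and
  \<open>r\<^sub>i + r\<^sub>j\<close>, so this is the numerator of the product over pairs in the
  theorem. For \<open>{0..<int t}\<close> it is the denominator.\<close>

definition diff_sum_prod :: "(int \<Rightarrow> 'a::field) \<Rightarrow> int set \<Rightarrow> 'a" where
  "diff_sum_prod \<tau> S = (\<Prod>(a, b)\<in>{(a, b). a \<in> S \<and> b \<in> S \<and> b < a}. \<tau> (a - b) * \<tau> (a + b + 1))"

definition hook_weight :: "nat \<Rightarrow> (int \<Rightarrow> 'a::field) \<Rightarrow> int \<times> int \<Rightarrow> 'a" where
  "hook_weight t \<tau> = (\<lambda>(x, y). \<tau> (x + y + 1 - (if x < y then -1 else 1) * (2 * int t)) / \<tau> (x + y + 1))"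

definition pair_alpha :: "nat \<Rightarrow> int set \<Rightarrow> nat \<Rightarrow> nat" where
  "pair_alpha t X i = card {(x, y) \<in> pos_pairs X. x + y + 1 = 2 * int t - int i \<and> y \<le> x}"

section \<open>Products over pairs and along chains\<close>

lemma diff_sum_prod_insert:
  fixes \<tau> :: "int \<Rightarrow> 'a::field"
  assumes "finite S" "q \<notin> S"
  shows "diff_sum_prod \<tau> (insert q S) = diff_sum_prod \<tau> S * (\<Prod>b\<in>S. \<tau> \<bar>q - b\<bar> * \<tau> (q + b + 1))"
proof -
  let ?E = "\<lambda>S. {(a, b). a \<in> S \<and> b \<in> S \<and> b < a}"
  let ?f = "\<lambda>(a, b). \<tau> (a - b) * \<tau> (a + b + 1)"
  let ?L = "{b \<in> S. b < q}" and ?G = "{b \<in> S. q < b}"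
  have fin: "finite (?E S)"
    by (rule finite_subset[of _ "S \<times> S"]) (use assms in auto)
  \<comment> \<open>The new element is the larger member of some pairs and the smaller member of
    others; the absolute value treats both alike.\<close>
  have "?E (insert q S) = ?E S \<union> (Pair q ` ?L \<union> (\<lambda>b. (b, q)) ` ?G)"
    by auto
  then have "prod ?f (?E (insert q S)) = prod ?f (?E S \<union> (Pair q ` ?L \<union> (\<lambda>b. (b, q)) ` ?G))"
    by simp
  also have "\<dots> = prod ?f (?E S) * prod ?f (Pair q ` ?L \<union> (\<lambda>b. (b, q)) ` ?G)"
    by (rule prod.union_disjoint) (use assms fin in auto)
  also have "prod ?f (Pair q ` ?L \<union> (\<lambda>b. (b, q)) ` ?G)
      = prod ?f (Pair q ` ?L) * prod ?f ((\<lambda>b. (b, q)) ` ?G)"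
    by (rule prod.union_disjoint) (use assms in auto)
  also have "prod ?f (Pair q ` ?L) = (\<Prod>b\<in>?L. \<tau> \<bar>q - b\<bar> * \<tau> (q + b + 1))"
    by (subst prod.reindex) (auto simp: inj_on_def intro!: prod.cong)
  also have "prod ?f ((\<lambda>b. (b, q)) ` ?G) = (\<Prod>b\<in>?G. \<tau> \<bar>q - b\<bar> * \<tau> (q + b + 1))"
    by (subst prod.reindex) (auto simp: inj_on_def add_ac intro!: prod.cong)
  also have "(\<Prod>b\<in>?L. \<tau> \<bar>q - b\<bar> * \<tau> (q + b + 1)) * (\<Prod>b\<in>?G. \<tau> \<bar>q - b\<bar> * \<tau> (q + b + 1))
      = (\<Prod>b\<in>?L \<union> ?G. \<tau> \<bar>q - b\<bar> * \<tau> (q + b + 1))"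
    by (rule prod.union_disjoint[symmetric]) (use assms in auto)
  also have "?L \<union> ?G = S"
    using assms by (auto intro: linorder_cases[of _ q])
  finally show ?thesis
    by (simp add: diff_sum_prod_def)
qed

lemma diff_sum_prod_nonzero:
  assumes "finite S" "\<And>k. \<tau> k \<noteq> 0"
  shows "diff_sum_prod \<tau> S \<noteq> 0"
proof -
  have "finite {(a, b). a \<in> S \<and> b \<in> S \<and> b < a}"
    by (rule finite_subset[of _ "S \<times> S"]) (use assms in auto)
  then show ?thesis
    using assms by (auto simp: diff_sum_prod_def prod_zero_iff)
qed

lemma diff_sum_prod_enum:
  fixes s :: "nat \<Rightarrow> int"
  assumes "s ` {1..t} = S" "\<And>i j. 1 \<le> i \<Longrightarrow> i < j \<Longrightarrow> j \<le> t \<Longrightarrow> s j < s i"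
  shows "diff_sum_prod \<tau> S = (\<Prod>(i, j)\<in>{(i, j). 1 \<le> i \<and> i < j \<and> j \<le> t}.
    \<tau> (s i - s j) * \<tau> (s i + s j + 1))"
proof -
  let ?P = "{(i, j). 1 \<le> i \<and> i < j \<and> j \<le> t}"
  have le: "s i < s j \<longleftrightarrow> j < i" if "i \<in> {1..t}" "j \<in> {1..t}" for i j
    using assms(2)[of i j] assms(2)[of j i] that
    by (metis atLeastAtMost_iff less_asym less_irrefl nat_neq_iff)
  have "bij_betw (\<lambda>(i, j). (s i, s j)) ?P {(a, b). a \<in> S \<and> b \<in> S \<and> b < a}"
  proof (rule bij_betwI')
    fix p q assume "p \<in> ?P" "q \<in> ?P"
    then show "((case p of (i, j) \<Rightarrow> (s i, s j)) = (case q of (i, j) \<Rightarrow> (s i, s j))) = (p = q)"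
      using le by (auto split: prod.splits)
       (metis atLeastAtMost_iff less_irrefl nat_neq_iff order.trans less_imp_le)+
  next
    fix p assume "p \<in> ?P"
    then show "(case p of (i, j) \<Rightarrow> (s i, s j)) \<in> {(a, b). a \<in> S \<and> b \<in> S \<and> b < a}"
      using assms by (auto simp flip: assms(1))
  next
    fix q assume "q \<in> {(a, b). a \<in> S \<and> b \<in> S \<and> b < a}"
    then obtain i j where "q = (s i, s j)" "i \<in> {1..t}" "j \<in> {1..t}" "s j < s i"
      by (auto simp flip: assms(1))
    then show "\<exists>p\<in>?P. q = (case p of (i, j) \<Rightarrow> (s i, s j))"
      using le by (intro bexI[of _ "(i, j)"]) auto
  qed
  from prod.reindex_bij_betw[OF this, of "\<lambda>(a, b). \<tau> (a - b) * \<tau> (a + b + 1)", symmetric]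
  show ?thesis
    unfolding diff_sum_prod_def by (simp add: case_prod_beta)
qed

text \<open>Within a residue class \<open>W\<close> is a chain of step \<open>g\<close>. The
  elements above \<open>g\<close> are the shifts of those that are not chain tops, so inner factors
  cancel. Each product alone reduces to a quotient between chain bottoms and chain tops; exchanging
  the two denominators gives the claim.\<close>

lemma prod_shift_telescope:
  fixes \<tau> :: "int \<Rightarrow> 'a::field"
  assumes "finite W" "0 < g" "g \<notin> W" "\<And>w. w \<in> W \<Longrightarrow> 0 < w" "\<And>w. w \<in> W \<Longrightarrow> g < w \<Longrightarrow> w - g \<in> W"
    and nz: "\<And>k. \<tau> k \<noteq> 0"
  shows "(\<Prod>w\<in>W. \<tau> (w - g) / \<tau> w) * (\<Prod>w\<in>W. \<tau> (w + g) / \<tau> w)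
    = (\<Prod>w\<in>{w \<in> W. w < g}. \<tau> (w - g) / \<tau> w) * (\<Prod>w\<in>{w \<in> W. w + g \<notin> W}. \<tau> (w + g) / \<tau> w)"
proof -
  let ?L = "{w \<in> W. w < g}" and ?H = "{w \<in> W. g < w}"
  let ?I = "{w \<in> W. w + g \<in> W}" and ?T = "{w \<in> W. w + g \<notin> W}"
  have LH: "prod f W = prod f ?L * prod f ?H" for f :: "int \<Rightarrow> 'a"
  proof -
    have "?L \<union> ?H = W"
      using assms(3) by (auto intro: linorder_cases[of _ g])
    moreover have "prod f (?L \<union> ?H) = prod f ?L * prod f ?H"
      by (rule prod.union_disjoint) (use assms(1) in auto)
    ultimately show ?thesis
      by metis
  qed
  have TI: "prod f W = prod f ?T * prod f ?I" for f :: "int \<Rightarrow> 'a"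
  proof -
    have "?T \<union> ?I = W"
      by auto
    moreover have "prod f (?T \<union> ?I) = prod f ?T * prod f ?I"
      by (rule prod.union_disjoint) (use assms(1) in auto)
    ultimately show ?thesis
      by metis
  qed
  have H: "?H = (\<lambda>w. w + g) ` ?I"
  proof -
    have "w \<in> (\<lambda>w. w + g) ` ?I" if "w \<in> ?H" for w
      using that assms(5) by (intro image_eqI[of _ _ "w - g"]) auto
    then show ?thesis
      using assms(4) by force
  qed
  have down: "(\<Prod>w\<in>?H. \<tau> (w - g)) = (\<Prod>w\<in>?I. \<tau> w)"
    unfolding H by (subst prod.reindex) (auto simp: inj_on_def)
  have up: "(\<Prod>w\<in>?H. \<tau> w) = (\<Prod>w\<in>?I. \<tau> (w + g))"
    unfolding H by (subst prod.reindex) (auto simp: inj_on_def)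
  have fin: "finite ?L" "finite ?H" "finite ?I" "finite ?T"
    using assms(1) by auto
  have "(\<Prod>w\<in>W. \<tau> (w - g) / \<tau> w) = (\<Prod>w\<in>?L. \<tau> (w - g)) * (\<Prod>w\<in>?I. \<tau> w) / (\<Prod>w\<in>W. \<tau> w)"
    by (simp add: prod_dividef LH[of "\<lambda>w. \<tau> (w - g)"] down)
  also have "(\<Prod>w\<in>W. \<tau> w) = (\<Prod>w\<in>?T. \<tau> w) * (\<Prod>w\<in>?I. \<tau> w)"
    by (rule TI)
  finally have 1: "(\<Prod>w\<in>W. \<tau> (w - g) / \<tau> w) = (\<Prod>w\<in>?L. \<tau> (w - g)) / (\<Prod>w\<in>?T. \<tau> w)"
    using fin nz by (simp add: prod_zero_iff)
  have "(\<Prod>w\<in>W. \<tau> (w + g) / \<tau> w) = (\<Prod>w\<in>?T. \<tau> (w + g)) * (\<Prod>w\<in>?H. \<tau> w) / (\<Prod>w\<in>W. \<tau> w)"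
    by (simp add: prod_dividef TI[of "\<lambda>w. \<tau> (w + g)"] up)
  also have "(\<Prod>w\<in>W. \<tau> w) = (\<Prod>w\<in>?L. \<tau> w) * (\<Prod>w\<in>?H. \<tau> w)"
    by (rule LH)
  finally have 2: "(\<Prod>w\<in>W. \<tau> (w + g) / \<tau> w) = (\<Prod>w\<in>?T. \<tau> (w + g)) / (\<Prod>w\<in>?L. \<tau> w)"
    using fin nz by (simp add: prod_zero_iff)
  show ?thesis
    unfolding 1 2 by (simp add: prod_dividef)
qed

text \<open>Replacing the maximal bead \<open>M\<close> by \<open>-1 - M\<close> removes the first row and the first column of the
  partition. On the tops it replaces \<open>\<plusminus>r\<^sub>1\<close> by \<open>\<plusminus>(r\<^sub>1 - g)\<close>; here \<open>R\<close> and \<open>q\<close> encode \<open>r\<^sub>1\<close> and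
  \<open>\<bar>r\<^sub>1 - g\<bar>\<close>.\<close>
locale sym_core_peel =
  fixes t :: nat and X :: "int set" and M :: int
  assumes t: "1 \<le> t" and sc: "sym_core t X"
    and M: "M \<in> X" "0 \<le> M" and max: "\<And>x. x \<in> X \<Longrightarrow> x \<le> M"
begin

abbreviation "g \<equiv> 2 * int t"
abbreviation "R \<equiv> M + int t"
abbreviation "q \<equiv> (if g \<le> R then R - g else g - 1 - R)"

definition "Y = insert (-1 - M) (X - {M})"
text \<open>These are the beads \<open>y\<close> for which \<open>(M, y)\<close> is a box, so the
  numbers \<open>M + y + 1\<close> are the hook lengths of the first row.\<close>

definition "N = {y \<in> X. -1 - M < y}"
definition "S0 = tops t X - {R}"

lemma sym: "k \<in> X \<longleftrightarrow> -1 - k \<notin> X"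
  using sc unfolding sym_core_def by blast

lemma core: "k \<in> X \<Longrightarrow> k - g \<in> X"
  using sc unfolding sym_core_def by blast

lemma finite_nonneg: "finite {x \<in> X. 0 \<le> x}"
  using sc unfolding sym_core_def by blast

lemma low: "x < -1 - M \<Longrightarrow> x \<in> X"
  using max[of "-1 - x"] sym[of x] by force

lemma neg_M: "-1 - M \<notin> X"
  using M sym by blast

lemma Y_iff: "k \<in> Y \<longleftrightarrow> k = -1 - M \<or> k \<in> X \<and> k \<noteq> M"
  by (auto simp: Y_def)

lemma sym_core_Y: "sym_core t Y"
  unfolding sym_core_def
proof (intro conjI allI ballI)
  show "finite {x \<in> Y. 0 \<le> x}"
    by (rule finite_subset[OF _ finite_nonneg]) (use M in \<open>auto simp: Y_iff\<close>)
next
  fix k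
  show "k \<in> Y \<longleftrightarrow> -1 - k \<notin> Y"
    using sym[of k] M by (auto simp: Y_iff)
next
  fix k assume "k \<in> Y"
  then show "k - g \<in> Y"
    \<comment> \<open>The new bead is harmless because everything below \<open>-1 - M\<close> is a
      bead; the loss of \<open>M\<close> is harmless because \<open>k - g < M\<close>.\<close>
    using core[of k] low[of "k - g"] max[of k] M t by (auto simp: Y_iff)
qed

lemma card_Y_less: "card {x \<in> Y. 0 \<le> x} < card {x \<in> X. 0 \<le> x}"
proof (rule psubset_card_mono)
  show "finite {x \<in> X. 0 \<le> x}"
    by (fact finite_nonneg)
  show "{x \<in> Y. 0 \<le> x} \<subset> {x \<in> X. 0 \<le> x}"
    using M by (auto simp: Y_iff)
qed

section \<open>The boxes of the removed row and column\<close>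

lemma N_subset: "N \<subseteq> {-M..M}"
  using max by (force simp: N_def)

lemma finite_N: "finite N"
  using N_subset finite_subset by blast

lemma M_in_N: "M \<in> N"
  using M by (simp add: N_def)

text \<open>The reflection pairs up the \<open>2 * M\<close> integers from \<open>-M\<close> to
  \<open>M - 1\<close>, and exactly one of each pair is a bead. The bead \<open>M\<close> itself is
  the additional one.\<close>

lemma card_N: "int (card N) = M + 1"
proof -
  let ?A = "N - {M}"
  have "{-M..M - 1} \<subseteq> ?A \<union> (\<lambda>y. -1 - y) ` ?A"
  proof
    fix k assume k: "k \<in> {-M..M - 1}"
    show "k \<in> ?A \<union> (\<lambda>y. -1 - y) ` ?A"
    proof (cases "k \<in> X")
      case False
      then show ?thesis
        using k sym[of k] by (intro UnI2 image_eqI[of _ _ "-1 - k"]) (auto simp: N_def)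
    next
      case True
      then show ?thesis
        using k by (intro UnI1) (simp add: N_def)
    qed
  qed
  moreover have "?A \<union> (\<lambda>y. -1 - y) ` ?A \<subseteq> {-M..M - 1}"
    using N_subset by (force simp: N_def)
  ultimately have "{-M..M - 1} = ?A \<union> (\<lambda>y. -1 - y) ` ?A"
    by blast
  moreover have "?A \<inter> (\<lambda>y. -1 - y) ` ?A = {}"
    using sym unfolding N_def by blast
  then have "card (?A \<union> (\<lambda>y. -1 - y) ` ?A) = card ?A + card ((\<lambda>y. -1 - y) ` ?A)"
    using finite_N by (intro card_Un_disjoint) auto
  moreover have "card ((\<lambda>y. -1 - y) ` ?A) = card ?A"
    by (intro card_image) (auto simp: inj_on_def)
  ultimately have "card {-M..M - 1} = 2 * card ?A"
    by simp
  then have "int (card ?A) = M"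
    using M by simp
  then show ?thesis
    using finite_N M_in_N by (simp add: card_Diff_singleton)
      (metis One_nat_def Suc_pred card_gt_0_iff empty_iff int_ops(4) of_nat_Suc)
qed

text \<open>The new bead \<open>-1 - M\<close> creates no box since no bead exceeds
  \<open>M\<close>. The corner \<open>(M, M)\<close> is counted with the row, hence
  \<open>N - {M}\<close> for the column.\<close>

lemma pos_pairs_X: "pos_pairs X = pos_pairs Y \<union> (Pair M ` N \<union> (\<lambda>x. (x, M)) ` (N - {M}))"
proof (intro equalityI subsetI)
  fix p assume "p \<in> pos_pairs X"
  then show "p \<in> pos_pairs Y \<union> (Pair M ` N \<union> (\<lambda>x. (x, M)) ` (N - {M}))"
    by (auto simp: pos_pairs_def Y_iff N_def)
next
  fix p assume "p \<in> pos_pairs Y \<union> (Pair M ` N \<union> (\<lambda>x. (x, M)) ` (N - {M}))"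
  then show "p \<in> pos_pairs X"
    using M max by (auto simp: pos_pairs_def Y_iff N_def) (force dest: max)+
qed

lemma M_notin_Y: "M \<notin> Y"
  using M by (auto simp: Y_iff)

lemma pos_pairs_disjoint:
  "pos_pairs Y \<inter> (Pair M ` N \<union> (\<lambda>x. (x, M)) ` (N - {M})) = {}"
  using M_notin_Y by (auto simp: pos_pairs_def)

lemma prod_pos_pairs:
  assumes "finite (pos_pairs Y)"
  shows "prod f (pos_pairs X)
    = prod f (pos_pairs Y) * ((\<Prod>y\<in>N. f (M, y)) * (\<Prod>y\<in>N - {M}. f (y, M)))"
proof -
  have "prod f (Pair M ` N \<union> (\<lambda>x. (x, M)) ` (N - {M}))
      = prod f (Pair M ` N) * prod f ((\<lambda>x. (x, M)) ` (N - {M}))"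
    by (rule prod.union_disjoint) (use finite_N in auto)
  then have "prod f (Pair M ` N \<union> (\<lambda>x. (x, M)) ` (N - {M}))
      = (\<Prod>y\<in>N. f (M, y)) * (\<Prod>y\<in>N - {M}. f (y, M))"
    by (simp add: prod.reindex inj_on_def)
  then show ?thesis
    unfolding pos_pairs_X using assms finite_N pos_pairs_disjoint
    by (subst prod.union_disjoint) auto
qed

lemma card_pos_pairs:
  assumes "finite (pos_pairs Y)"
  shows "int (card (pos_pairs X)) = int (card (pos_pairs Y)) + 2 * M + 1"
proof -
  have "card (Pair M ` N \<union> (\<lambda>x. (x, M)) ` (N - {M}))
      = card (Pair M ` N) + card ((\<lambda>x. (x, M)) ` (N - {M}))"
    by (rule card_Un_disjoint) (use finite_N in auto)
  also have "\<dots> = card N + (card N - 1)"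
    using finite_N M_in_N by (simp add: card_image inj_on_def)
  finally have "card (pos_pairs X) = card (pos_pairs Y) + (card N + (card N - 1))"
    unfolding pos_pairs_X using assms finite_N pos_pairs_disjoint
    by (subst card_Un_disjoint) auto
  moreover have "1 \<le> card N"
    using card_N M by linarith
  ultimately show ?thesis
    using card_N by simp
qed

lemma finite_pos_pairs: "finite (pos_pairs Y) \<Longrightarrow> finite (pos_pairs X)"
  unfolding pos_pairs_X using finite_N by auto

text \<open>Boxes \<open>(x, M)\<close> of the column with \<open>x < M\<close> have the other sign.
  In the row the hook length determines the box, so at most one is added.\<close>

lemma pair_alpha_X:
  assumes "finite (pos_pairs Y)" "i < 2 * t"
  shows "pair_alpha t X i = pair_alpha t Y i + (if g - int i - 1 - M \<in> X then 1 else 0)"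
proof -
  let ?A = "\<lambda>X. {(x, y) \<in> pos_pairs X. x + y + 1 = g - int i \<and> y \<le> x}"
  let ?p = "(M, g - int i - 1 - M)"
  have fin: "finite (?A Y)"
    by (rule finite_subset[OF _ assms(1)]) auto
  have notin: "?p \<notin> ?A Y"
    using M_notin_Y by (auto simp: pos_pairs_def)
  have "?A X = ?A Y \<union> (if g - int i - 1 - M \<in> X then {?p} else {})"
  proof (intro equalityI subsetI)
    fix p assume p: "p \<in> ?A X"
    show "p \<in> ?A Y \<union> (if g - int i - 1 - M \<in> X then {?p} else {})"
    proof (cases "p \<in> pos_pairs Y")
      case False
      then consider y where "p = (M, y)" "y \<in> N" | x where "p = (x, M)" "x \<in> N - {M}"
        using p pos_pairs_X by blast
      then show ?thesis
      proof cases
        case 1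
        then have "y = g - int i - 1 - M" "y \<in> X"
          using p by (auto simp: N_def)
        then show ?thesis
          using 1 by simp
      next
        case 2
        then show ?thesis
          using p max[of x] by (auto simp: N_def)
      qed
    qed (use p in auto)
  next
    fix p assume p: "p \<in> ?A Y \<union> (if g - int i - 1 - M \<in> X then {?p} else {})"
    then show "p \<in> ?A X"
    proof (cases "p \<in> ?A Y")
      case True
      then show ?thesis
        unfolding pos_pairs_X by auto
    next
      case False
      with p have "g - int i - 1 - M \<in> X" "p = ?p"
        by (auto split: if_splits)
      then show ?thesis
        using M max[of "g - int i - 1 - M"] assms(2) by (auto simp: pos_pairs_def)
    qed
  qed
  then have "card (?A X) = card (?A Y \<union> (if g - int i - 1 - M \<in> X then {?p} else {}))"
    by simp
  then show ?thesis
    unfolding pair_alpha_def using fin notin by (cases "g - int i - 1 - M \<in> X") simp_all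
qed

section \<open>Effect of the removal on the tops\<close>

lemma R_in_tops: "R \<in> tops t X"
  using M max[of "R + int t"] t by (force simp: tops_def)

lemma tops_le: "b \<in> tops t X \<Longrightarrow> b \<le> R"
  using max[of "b - int t"] by (auto simp: tops_def)

lemma finite_S0: "finite S0"
  by (rule finite_subset[of _ "{0..R}"]) (use tops_le in \<open>auto simp: S0_def tops_def\<close>)

lemma R_notin_S0: "R \<notin> S0"
  by (simp add: S0_def)

lemma tops_X: "tops t X = insert R S0"
  using R_in_tops by (auto simp: S0_def)

text \<open>For \<open>g \<le> R\<close> one has \<open>q + int t = M\<close>, a bead; otherwise
  \<open>q - int t = -1 - M\<close>, a gap. Either excludes \<open>q\<close> from the tops of
  \<open>X\<close>.\<close>

lemma q_notin_S0: "q \<notin> S0"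
  using M neg_M by (auto simp: S0_def tops_def algebra_simps)

lemma q_in_tops_Y: "q \<in> tops t Y"
proof (cases "g \<le> R")
  case True
  then show ?thesis
    using core[OF M(1)] M t by (auto simp: tops_def Y_iff)
next
  case False
  have "g - 1 - M \<notin> X"
    using sym[of "g - 1 - M"] core[OF M(1)] by (simp add: algebra_simps)
  then show ?thesis
    using False t M by (auto simp: tops_def Y_iff algebra_simps)
qed

text \<open>The status of \<open>b\<close> can change only if \<open>b - int t\<close> or
  \<open>b + int t\<close> is \<open>M\<close> or \<open>-1 - M\<close>. Among nonnegative
  \<open>b\<close> this leaves \<open>R\<close>, which is lost, and \<open>q\<close>, which is
  gained.\<close>

lemma tops_Y: "tops t Y = insert q S0"
proof (intro equalityI subsetI)
  fix b assume b: "b \<in> tops t Y"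
  show "b \<in> insert q S0"
  proof (cases "b = q")
    case False
    then show ?thesis
      using b M by (auto simp: tops_def S0_def Y_iff split: if_splits)
  qed simp
next
  fix b assume b: "b \<in> insert q S0"
  show "b \<in> tops t Y"
  proof (cases "b = q")
    case True
    then show ?thesis
      using q_in_tops_Y by simp
  next
    case False
    then show ?thesis
      using b M by (auto simp: tops_def S0_def Y_iff split: if_splits)
  qed
qed

section \<open>The telescoped product over the removed boxes\<close>

definition "T = S0 \<union> (\<lambda>b. -1 - b) ` S0"
text \<open>The residues \<open>1, \<dots>, g - 1\<close> split into \<open>L\<close>, the hook lengths below \<open>g\<close> in the first row, and \<open>J\<close>,
  the values \<open>r\<^sub>1 + \<rho>\<close> below \<open>g\<close> with \<open>\<rho> \<in> {\<plusminus>r\<^sub>2, \<dots>, \<plusminus>r\<^sub>t}\<close>; see \<open>J_eq\<close>.\<close>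
definition "T_low = {b \<in> T. R + b + 1 < g}"
definition "T_high = {b \<in> T. g < R + b + 1}"
definition "L = {s \<in> {1..g - 1}. s - 1 - M \<in> X}"
definition "J = {s \<in> {1..g - 1}. s - 1 - M \<notin> X}"

text \<open>Here \<open>b\<close> encodes \<open>\<rho> - 1/2\<close> with \<open>\<rho>\<close>
  among \<open>\<plusminus>r\<^sub>2, ..., \<plusminus>r\<^sub>t\<close>. The reflection
  \<open>b -> -1 - b\<close> exchanges the two bead conditions of a top, so both signs satisfy the
  same description.\<close>

lemma T_iff: "b \<in> T \<longleftrightarrow> b - int t \<in> X \<and> b + int t \<notin> X \<and> b \<noteq> R \<and> b \<noteq> -1 - R"
proof -
  have "b \<in> (\<lambda>b. -1 - b) ` S0 \<longleftrightarrow> -1 - b \<in> S0"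
    by force
  moreover have "-1 - b - int t \<in> X \<longleftrightarrow> b + int t \<notin> X" "-1 - b + int t \<in> X \<longleftrightarrow> b - int t \<notin> X"
    using sym[of "b + int t"] sym[of "b - int t"] by (simp_all add: algebra_simps)
  ultimately show ?thesis
    using M by (auto simp: T_def S0_def tops_def)
qed

lemma finite_T: "finite T"
  using finite_S0 by (simp add: T_def)

lemma T_split: "T_low \<union> T_high = T" "T_low \<inter> T_high = {}"
proof -
  \<comment> \<open>Equality would make the gap \<open>-1 - M\<close> equal to the bead
    \<open>b - int t\<close>.\<close>
  have "R + b + 1 \<noteq> g" if "b \<in> T" for b
  proof
    assume "R + b + 1 = g"
    then have "b - int t = -1 - M"
      by simp
    then show False
      using that neg_M T_iff by metis
  qed
  then show "T_low \<union> T_high = T"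
    unfolding T_low_def T_high_def by (blast intro: linorder_cases)
  show "T_low \<inter> T_high = {}"
    by (auto simp: T_low_def T_high_def)
qed

text \<open>For \<open>s\<close> in \<open>{1..g - 1}\<close> put \<open>b = s - 1 - R\<close>. Then
  \<open>b - int t\<close> lies below \<open>-1 - M\<close> and is automatically a bead, so
  \<open>b\<close> is a runner top iff \<open>b + int t = s - 1 - M\<close> is a gap.\<close>

lemma J_eq: "J = (\<lambda>b. R + b + 1) ` T_low"
proof (intro equalityI subsetI)
  fix s assume s: "s \<in> J"
  then have "s - 1 - M - g \<in> X"
    by (intro low) (auto simp: J_def)
  with s have "s - 1 - R \<in> T_low"
    using M t by (auto simp: T_low_def T_iff J_def algebra_simps)
  then show "s \<in> (\<lambda>b. R + b + 1) ` T_low"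
    by (rule rev_image_eqI) simp
next
  fix s assume "s \<in> (\<lambda>b. R + b + 1) ` T_low"
  then obtain b where b: "b \<in> T_low" "s = R + b + 1"
    by blast
  then have "b + int t \<notin> X" "b \<noteq> -1 - R"
    by (auto simp: T_low_def T_iff)
  moreover have "-1 - M \<le> b + int t"
    using calculation low by force
  ultimately show "s \<in> J"
    using b by (auto simp: J_def T_low_def algebra_simps)
qed

lemma finite_LJ: "finite L" "finite J"
  by (rule finite_subset[of _ "{1..g - 1}"]; auto simp: L_def J_def)+

text \<open>\<open>L\<close> and \<open>J\<close> partition \<open>{1..g - 1}\<close>, which
  \<open>s -> g - s\<close> permutes.\<close>

lemma prod_LJ:
  fixes \<tau> :: "int \<Rightarrow> 'a::field"
  shows "(\<Prod>s\<in>L. \<tau> s) * (\<Prod>s\<in>J. \<tau> s) = (\<Prod>s\<in>L. \<tau> (g - s)) * (\<Prod>s\<in>J. \<tau> (g - s))"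
proof -
  have split: "(\<Prod>s\<in>L. f s) * (\<Prod>s\<in>J. f s) = (\<Prod>s\<in>{1..g - 1}. f s)" for f :: "int \<Rightarrow> 'a"
  proof -
    have "(\<Prod>s\<in>L \<union> J. f s) = (\<Prod>s\<in>L. f s) * (\<Prod>s\<in>J. f s)"
      by (rule prod.union_disjoint) (use finite_LJ in \<open>auto simp: L_def J_def\<close>)
    moreover have "L \<union> J = {1..g - 1}"
      by (auto simp: L_def J_def)
    ultimately show ?thesis
      by simp
  qed
  have "(\<Prod>s\<in>{1..g - 1}. \<tau> (g - s)) = (\<Prod>s\<in>{1..g - 1}. \<tau> s)"
    by (rule prod.reindex_bij_witness[of _ "\<lambda>s. g - s" "\<lambda>s. g - s"]) auto
  then show ?thesis
    unfolding split by simp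
qed

text \<open>Row and column have the same hook lengths \<open>W\<close>, but the sign is 1 in the row
  and -1 below the corner. This gives the two shifted products of
  \<open>prod_shift_telescope\<close>; the chain tops other than the corner's hook length
  \<open>m\<close> correspond to \<open>T_high\<close>.\<close>

lemma prod_first_hooks:
  fixes \<tau> :: "int \<Rightarrow> 'a::field"
  assumes nz: "\<And>k. \<tau> k \<noteq> 0"
  shows "(\<Prod>y\<in>N. hook_weight t \<tau> (M, y)) * (\<Prod>y\<in>N - {M}. hook_weight t \<tau> (y, M))
    = (\<Prod>s\<in>L. \<tau> (s - g) / \<tau> s) * (\<Prod>b\<in>T_high. \<tau> (R + b + 1) / \<tau> (R + b + 1 - g))"
proof -
  define W where "W = (\<lambda>y. M + y + 1) ` N"
  define m where "m = 2 * M + 1"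
  have W_iff: "w \<in> W \<longleftrightarrow> 0 < w \<and> w - 1 - M \<in> X" for w
  proof
    assume "0 < w \<and> w - 1 - M \<in> X"
    then show "w \<in> W"
      unfolding W_def by (intro image_eqI[of _ _ "w - 1 - M"]) (auto simp: N_def)
  qed (auto simp: W_def N_def)
  have finW: "finite W"
    using finite_N by (simp add: W_def)
  have m: "m \<in> W" "m + g \<notin> W"
    using M max[of "M + g"] t by (auto simp: W_iff m_def algebra_simps)
  let ?T = "{w \<in> W. w + g \<notin> W}"
  have tele: "(\<Prod>w\<in>W. \<tau> (w - g) / \<tau> w) * (\<Prod>w\<in>W. \<tau> (w + g) / \<tau> w)
    = (\<Prod>w\<in>{w \<in> W. w < g}. \<tau> (w - g) / \<tau> w) * (\<Prod>w\<in>?T. \<tau> (w + g) / \<tau> w)"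
  proof (rule prod_shift_telescope[OF finW])
    \<comment> \<open>A hook length \<open>g\<close> would make \<open>g - 1 - M\<close> a bead and
      then, by the core property, also \<open>-1 - M\<close>.\<close>
    show "g \<notin> W"
      using core[of "g - 1 - M"] neg_M by (auto simp: W_iff)
    show "w - g \<in> W" if "w \<in> W" "g < w" for w
      using that core[of "w - 1 - M"] by (simp add: W_iff algebra_simps)
  qed (use t nz in \<open>auto simp: W_iff\<close>)
  have low: "{w \<in> W. w < g} = L"
    by (auto simp: W_iff L_def)
  have high: "?T - {m} = (\<lambda>b. R + b + 1 - g) ` T_high"
  proof (intro equalityI subsetI)
    fix w assume w: "w \<in> ?T - {m}"
    then have "w + g - 1 - R \<in> T_high"
      by (auto simp: T_high_def T_iff W_iff m_def algebra_simps)
    then show "w \<in> (\<lambda>b. R + b + 1 - g) ` T_high"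
      by (rule rev_image_eqI) simp
  next
    fix w assume "w \<in> (\<lambda>b. R + b + 1 - g) ` T_high"
    then show "w \<in> ?T - {m}"
      by (auto simp: T_high_def T_iff W_iff m_def algebra_simps)
  qed
  \<comment> \<open>The telescoping also counts the corner in the column product. As
    \<open>m\<close> is a chain top, the same nonzero factor occurs on the right and
    cancels.\<close>
  let ?u = "\<lambda>w. \<tau> (w + g) / \<tau> w"
  have "prod ?u W = ?u m * prod ?u (W - {m})"
    using finW m by (intro prod.remove) auto
  moreover have "prod ?u ?T = ?u m * prod ?u (?T - {m})"
    using finW m by (intro prod.remove) auto
  ultimately have "?u m * ((\<Prod>w\<in>W. \<tau> (w - g) / \<tau> w) * prod ?u (W - {m}))
      = ?u m * ((\<Prod>w\<in>L. \<tau> (w - g) / \<tau> w) * prod ?u (?T - {m}))"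
    using tele unfolding low by (simp only: mult.left_commute)
  moreover have "?u m \<noteq> 0"
    using nz by simp
  ultimately have main: "(\<Prod>w\<in>W. \<tau> (w - g) / \<tau> w) * prod ?u (W - {m})
      = (\<Prod>w\<in>L. \<tau> (w - g) / \<tau> w) * prod ?u (?T - {m})"
    by (rule mult_left_cancel[THEN iffD1, rotated])
  have "(\<Prod>y\<in>N. hook_weight t \<tau> (M, y)) = (\<Prod>w\<in>W. \<tau> (w - g) / \<tau> w)"
  proof -
    have "\<not> M < y" if "y \<in> N" for y
      using that max[of y] by (simp add: N_def)
    then show ?thesis
      unfolding W_def by (subst prod.reindex) (auto simp: inj_on_def hook_weight_def intro!: prod.cong)
  qed
  moreover have "(\<Prod>y\<in>N - {M}. hook_weight t \<tau> (y, M)) = prod ?u (W - {m})"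
  proof -
    have "W - {m} = (\<lambda>y. M + y + 1) ` (N - {M})"
      by (auto simp: W_def m_def)
    moreover have "y < M" if "y \<in> N - {M}" for y
      using that max[of y] by (auto simp: N_def)
    ultimately show ?thesis
      by (subst \<open>W - {m} = _\<close>, subst prod.reindex)
        (auto simp: inj_on_def hook_weight_def algebra_simps intro!: prod.cong)
  qed
  moreover have "prod ?u (?T - {m}) = (\<Prod>b\<in>T_high. \<tau> (R + b + 1) / \<tau> (R + b + 1 - g))"
    unfolding high by (subst prod.reindex) (auto simp: inj_on_def add_ac)
  ultimately show ?thesis
    using main by simp
qed

text \<open>Only pairs involving \<open>r\<^sub>1\<close> change. Each other
  \<open>r\<^sub>i\<close> enters \<open>T\<close> with both signs, as \<open>b\<close> and
  \<open>-1 - b\<close>. Since \<open>q\<close> encodes \<open>\<bar>r\<^sub>1 - g\<bar>\<close>,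
  the two denominators have arguments \<open>\<bar>q - b\<bar>\<close> and \<open>q + b + 1\<close>,
  in an order that depends on whether \<open>g \<le> R\<close>.\<close>

lemma diff_sum_prod_tops:
  fixes \<tau> :: "int \<Rightarrow> 'a::field"
  assumes nz: "\<And>k. \<tau> k \<noteq> 0"
  shows "diff_sum_prod \<tau> (tops t X)
    = diff_sum_prod \<tau> (tops t Y) * (\<Prod>b\<in>T. \<tau> (R + b + 1) / \<tau> \<bar>R + b + 1 - g\<bar>)"
proof -
  let ?F = "\<lambda>b. \<tau> (R + b + 1) / \<tau> \<bar>R + b + 1 - g\<bar>"
  have "(\<Prod>b\<in>T. ?F b) = (\<Prod>b\<in>S0. ?F b) * (\<Prod>b\<in>(\<lambda>b. -1 - b) ` S0. ?F b)"
    unfolding T_def by (rule prod.union_disjoint) (use finite_S0 in \<open>auto simp: S0_def tops_def\<close>)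
  also have "(\<Prod>b\<in>(\<lambda>b. -1 - b) ` S0. ?F b) = (\<Prod>b\<in>S0. ?F (-1 - b))"
    by (subst prod.reindex) (auto simp: inj_on_def)
  also have "(\<Prod>b\<in>S0. ?F b) * (\<Prod>b\<in>S0. ?F (-1 - b)) = (\<Prod>b\<in>S0. ?F b * ?F (-1 - b))"
    by (rule prod.distrib[symmetric])
  also have "\<dots> = (\<Prod>b\<in>S0. (\<tau> \<bar>R - b\<bar> * \<tau> (R + b + 1)) / (\<tau> \<bar>q - b\<bar> * \<tau> (q + b + 1)))"
  proof (rule prod.cong[OF refl])
    fix b assume "b \<in> S0"
    then have b: "0 \<le> b" "b \<le> R"
      using tops_le by (auto simp: S0_def tops_def)
    then have e: "R + (-1 - b) + 1 = \<bar>R - b\<bar>"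
      by simp
    show "?F b * ?F (-1 - b) = (\<tau> \<bar>R - b\<bar> * \<tau> (R + b + 1)) / (\<tau> \<bar>q - b\<bar> * \<tau> (q + b + 1))"
    proof (cases "g \<le> R")
      case True
      then have "\<bar>R + b + 1 - g\<bar> = q + b + 1" "\<bar>\<bar>R - b\<bar> - g\<bar> = \<bar>q - b\<bar>"
        using b by auto
      then show ?thesis
        unfolding e times_divide_times_eq by (metis mult.commute)
    next
      case False
      then have "\<bar>R + b + 1 - g\<bar> = \<bar>q - b\<bar>" "\<bar>\<bar>R - b\<bar> - g\<bar> = q + b + 1"
        using b by auto
      then show ?thesis
        unfolding e times_divide_times_eq by (metis mult.commute)
    qed
  qed
  also have "\<dots> = (\<Prod>b\<in>S0. \<tau> \<bar>R - b\<bar> * \<tau> (R + b + 1)) / (\<Prod>b\<in>S0. \<tau> \<bar>q - b\<bar> * \<tau> (q + b + 1))"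
    by (rule prod_dividef)
  finally have T: "(\<Prod>b\<in>T. ?F b) * (\<Prod>b\<in>S0. \<tau> \<bar>q - b\<bar> * \<tau> (q + b + 1))
      = (\<Prod>b\<in>S0. \<tau> \<bar>R - b\<bar> * \<tau> (R + b + 1))"
    using finite_S0 nz by (simp add: prod_zero_iff)
  show ?thesis
    unfolding tops_X tops_Y diff_sum_prod_insert[OF finite_S0 R_notin_S0]
      diff_sum_prod_insert[OF finite_S0 q_notin_S0]
    by (simp only: T[symmetric] mult_ac)
qed

lemma prod_T:
  fixes \<tau> :: "int \<Rightarrow> 'a::field"
  shows "(\<Prod>b\<in>T. \<tau> (R + b + 1) / \<tau> \<bar>R + b + 1 - g\<bar>)
    = (\<Prod>s\<in>J. \<tau> s / \<tau> (g - s)) * (\<Prod>b\<in>T_high. \<tau> (R + b + 1) / \<tau> (R + b + 1 - g))"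
proof -
  let ?F = "\<lambda>b. \<tau> (R + b + 1) / \<tau> \<bar>R + b + 1 - g\<bar>"
  have "(\<Prod>b\<in>T. ?F b) = (\<Prod>b\<in>T_low. ?F b) * (\<Prod>b\<in>T_high. ?F b)"
    using finite_T T_split(2) by (subst T_split(1)[symmetric], intro prod.union_disjoint)
      (auto simp: T_low_def T_high_def)
  also have "(\<Prod>b\<in>T_low. ?F b) = (\<Prod>b\<in>T_low. \<tau> (R + b + 1) / \<tau> (g - (R + b + 1)))"
  proof (rule prod.cong[OF refl])
    fix b assume "b \<in> T_low"
    then have "\<bar>R + b + 1 - g\<bar> = g - (R + b + 1)"
      by (auto simp: T_low_def)
    then show "?F b = \<tau> (R + b + 1) / \<tau> (g - (R + b + 1))"
      by (simp only:)
  qed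
  also have "\<dots> = (\<Prod>s\<in>J. \<tau> s / \<tau> (g - s))"
    unfolding J_eq by (subst prod.reindex) (simp_all add: inj_on_def)
  also have "(\<Prod>b\<in>T_high. ?F b) = (\<Prod>b\<in>T_high. \<tau> (R + b + 1) / \<tau> (R + b + 1 - g))"
    by (rule prod.cong) (auto simp: T_high_def)
  finally show ?thesis .
qed

text \<open>A hook length \<open>s < g\<close> of the first row raises the exponent of index
  \<open>i = g - s\<close> by one.\<close>

lemma prod_alpha:
  fixes \<tau> :: "int \<Rightarrow> 'a::field"
  assumes "finite (pos_pairs Y)"
  shows "(\<Prod>i=1..2 * t - 1. (\<tau> (- int i) / \<tau> (int i)) ^ pair_alpha t X i)
    = (\<Prod>i=1..2 * t - 1. (\<tau> (- int i) / \<tau> (int i)) ^ pair_alpha t Y i)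
      * (\<Prod>s\<in>L. \<tau> (s - g) / \<tau> (g - s))"
proof -
  let ?c = "\<lambda>i. \<tau> (- int i) / \<tau> (int i)"
  have "(\<Prod>i=1..2 * t - 1. ?c i ^ pair_alpha t X i)
      = (\<Prod>i=1..2 * t - 1. ?c i ^ pair_alpha t Y i * (if g - int i - 1 - M \<in> X then ?c i else 1))"
    using pair_alpha_X[OF assms] t by (intro prod.cong) (auto simp: power_add)
  also have "\<dots> = (\<Prod>i=1..2 * t - 1. ?c i ^ pair_alpha t Y i)
      * (\<Prod>i=1..2 * t - 1. if g - int i - 1 - M \<in> X then ?c i else 1)"
    by (rule prod.distrib)
  also have "(\<Prod>i=1..2 * t - 1. if g - int i - 1 - M \<in> X then ?c i else 1)
      = (\<Prod>i\<in>{i \<in> {1..2 * t - 1}. g - int i - 1 - M \<in> X}. ?c i)"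
    by (rule prod.inter_filter[symmetric]) simp
  also have "\<dots> = (\<Prod>s\<in>L. \<tau> (s - g) / \<tau> (g - s))"
    by (rule prod.reindex_bij_witness[of _ "\<lambda>s. nat (g - s)" "\<lambda>i. g - int i"])
      (use t in \<open>auto simp: L_def\<close>)
  finally show ?thesis .
qed

lemma sum_tops:
  "(\<Sum>b\<in>tops t X. (of_int b + 1 / 2 :: rat)\<^sup>2)
    = (\<Sum>b\<in>tops t Y. (of_int b + 1 / 2)\<^sup>2) + of_int g * (2 * of_int M + 1)"
proof -
  \<comment> \<open>The two cases of \<open>q\<close> differ in the sign of
    \<open>r\<^sub>1 - g\<close>, which squaring removes.\<close>
  have "(of_int q + 1 / 2 :: rat)\<^sup>2 = (of_int R + 1 / 2 - of_int g)\<^sup>2"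
    by (cases "g \<le> R") (simp_all add: power2_eq_square algebra_simps)
  then show ?thesis
    unfolding tops_X tops_Y using finite_S0 R_notin_S0 q_notin_S0
    by (simp add: power2_eq_square algebra_simps)
qed

text \<open>In the induction \<open>c\<close> is the product over \<open>{0..<int t}\<close>, the
  same at every stage.\<close>

lemma hook_product_step:
  fixes \<tau> :: "int \<Rightarrow> 'a::field"
  assumes nz: "\<And>k. \<tau> k \<noteq> 0" and fin: "finite (pos_pairs Y)"
    and Y: "(\<Prod>p\<in>pos_pairs Y. hook_weight t \<tau> p) * c
      = (\<Prod>i=1..2 * t - 1. (\<tau> (- int i) / \<tau> (int i)) ^ pair_alpha t Y i) * diff_sum_prod \<tau> (tops t Y)"
  shows "(\<Prod>p\<in>pos_pairs X. hook_weight t \<tau> p) * c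
      = (\<Prod>i=1..2 * t - 1. (\<tau> (- int i) / \<tau> (int i)) ^ pair_alpha t X i) * diff_sum_prod \<tau> (tops t X)"
proof -
  let ?H = "\<Prod>b\<in>T_high. \<tau> (R + b + 1) / \<tau> (R + b + 1 - g)"
  \<comment> \<open>The factors on \<open>L\<close> come from the exponents and those on
    \<open>J\<close> from the tops; \<open>prod_LJ\<close> merges them into the surviving hook
    factors.\<close>
  have "(\<Prod>s\<in>L. \<tau> (s - g) / \<tau> (g - s)) * (\<Prod>s\<in>J. \<tau> s / \<tau> (g - s)) = (\<Prod>s\<in>L. \<tau> (s - g) / \<tau> s)"
    using prod_LJ[of \<tau>] nz finite_LJ by (simp add: prod_dividef field_simps prod_zero_iff)
  then have "(\<Prod>y\<in>N. hook_weight t \<tau> (M, y)) * (\<Prod>y\<in>N - {M}. hook_weight t \<tau> (y, M))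
      = (\<Prod>s\<in>L. \<tau> (s - g) / \<tau> (g - s)) * (\<Prod>s\<in>J. \<tau> s / \<tau> (g - s)) * ?H"
    unfolding prod_first_hooks[OF nz] by simp
  then have "(\<Prod>p\<in>pos_pairs X. hook_weight t \<tau> p) * c
     = ((\<Prod>p\<in>pos_pairs Y. hook_weight t \<tau> p) * c)
       * ((\<Prod>s\<in>L. \<tau> (s - g) / \<tau> (g - s)) * (\<Prod>s\<in>J. \<tau> s / \<tau> (g - s)) * ?H)"
    unfolding prod_pos_pairs[OF fin] by (simp only: mult_ac)
  then show ?thesis
    unfolding Y diff_sum_prod_tops[OF nz] prod_T prod_alpha[OF fin] by (simp only: mult_ac)
qed

end

section \<open>The empty partition and the induction\<close>

lemma sym_core_without_nonneg:
  assumes "sym_core t X" "{x \<in> X. 0 \<le> x} = {}"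
  shows "X = {..<0}"
proof (intro set_eqI)
  fix x
  have "x \<in> X \<longleftrightarrow> -1 - x \<notin> X"
    using assms(1) unfolding sym_core_def by blast
  moreover have "x < 0" if "x \<in> X" for x
    using assms(2) that by force
  ultimately show "x \<in> X \<longleftrightarrow> x \<in> {..<0}"
    by force
qed

text \<open>The empty partition has \<open>r\<^sub>i = t - i + 1/2\<close>.\<close>

lemma tops_negatives: "tops t {..<0} = {0..<int t}"
  by (auto simp: tops_def)

text \<open>Divided by \<open>g = 2 * t\<close>, this is the constant
  \<open>(g\<^sup>2 - 1) / 24\<close>.\<close>

lemma sum_half_odd_squares:
  "(\<Sum>b\<in>{0..<int t}. (of_int b + 1 / 2 :: rat)\<^sup>2) = of_nat t * (4 * (of_nat t)\<^sup>2 - 1) / 12"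
proof (induction t)
  case (Suc t)
  have "{0..<int (Suc t)} = insert (int t) {0..<int t}"
    by auto
  then show ?case
    using Suc by (simp add: power2_eq_square field_simps)
qed simp

text \<open>The size formula is multiplied by \<open>g\<close> and the product formula by its
  constant denominator. Finiteness is carried along so that the cardinality and the product are not
  default values.\<close>

lemma sym_core_formulas:
  assumes "1 \<le> t" "sym_core t X"
  shows "finite (pos_pairs X)
    \<and> 2 * of_nat t * of_nat (card (pos_pairs X))
      = (\<Sum>b\<in>tops t X. (of_int b + 1 / 2 :: rat)\<^sup>2) - of_nat t * (4 * (of_nat t)\<^sup>2 - 1) / 12
    \<and> (\<forall>\<tau> :: int \<Rightarrow> 'a::field. (\<forall>k. \<tau> k \<noteq> 0) \<longrightarrow>
      (\<Prod>p\<in>pos_pairs X. hook_weight t \<tau> p) * diff_sum_prod \<tau> {0..<int t}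
      = (\<Prod>i=1..2 * t - 1. (\<tau> (- int i) / \<tau> (int i)) ^ pair_alpha t X i) * diff_sum_prod \<tau> (tops t X))"
  using assms(2)
proof (induction "card {x \<in> X. 0 \<le> x}" arbitrary: X rule: less_induct)
  case less
  show ?case
  proof (cases "{x \<in> X. 0 \<le> x} = {}")
    case True
    then have X: "X = {..<0}"
      using sym_core_without_nonneg less.prems by blast
    have pairs: "pos_pairs X = {}"
      by (auto simp: X pos_pairs_def)
    then have "pair_alpha t X = (\<lambda>_. 0)"
      by (simp add: pair_alpha_def fun_eq_iff)
    then show ?thesis
      unfolding pairs by (simp add: X tops_negatives sum_half_odd_squares)
  next
    case False
    have fin: "finite {x \<in> X. 0 \<le> x}"
      using less.prems unfolding sym_core_def by blast
    define M where "M = Max {x \<in> X. 0 \<le> x}"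
    have M: "M \<in> X" "0 \<le> M"
      using Max_in[OF fin False] by (auto simp: M_def)
    have "x \<le> M" if "x \<in> X" for x
      using that M Max_ge[OF fin, of x] by (cases "0 \<le> x") (auto simp: M_def)
    then interpret sym_core_peel t X M
      using assms(1) less.prems M by unfold_locales
    note IH = less.hyps[OF card_Y_less sym_core_Y]
    then have fin: "finite (pos_pairs Y)"
      by blast
    have "of_nat (card (pos_pairs X)) = (of_nat (card (pos_pairs Y)) + 2 * of_int M + 1 :: rat)"
      using arg_cong[OF card_pos_pairs[OF fin], of "of_int :: int \<Rightarrow> rat"] by simp
    moreover have "2 * of_nat t * of_nat (card (pos_pairs Y))
        = (\<Sum>b\<in>tops t Y. (of_int b + 1 / 2 :: rat)\<^sup>2) - of_nat t * (4 * (of_nat t)\<^sup>2 - 1) / 12"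
      using IH by blast
    ultimately have "2 * of_nat t * of_nat (card (pos_pairs X))
        = (\<Sum>b\<in>tops t X. (of_int b + 1 / 2 :: rat)\<^sup>2) - of_nat t * (4 * (of_nat t)\<^sup>2 - 1) / 12"
      unfolding sum_tops by (simp add: algebra_simps)
    moreover have "(\<Prod>p\<in>pos_pairs X. hook_weight t \<tau> p) * diff_sum_prod \<tau> {0..<int t}
      = (\<Prod>i=1..2 * t - 1. (\<tau> (- int i) / \<tau> (int i)) ^ pair_alpha t X i) * diff_sum_prod \<tau> (tops t X)"
      if "\<forall>k. \<tau> k \<noteq> 0" for \<tau> :: "int \<Rightarrow> 'a"
      using that IH by (intro hook_product_step fin) blast+
    ultimately show ?thesis
      using finite_pos_pairs[OF fin] by blast
  qed
qed

subsection \<open>Beads of a self-conjugate partition\<close>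

definition beads :: "nat list \<Rightarrow> int set" where
  "beads l = {k. word l k = 0}"

definition bead :: "nat list \<Rightarrow> nat \<Rightarrow> int" where
  "bead l i = int (part l i) - int i"

lemma beads_eq: "beads l = bead l ` {1..}"
  by (auto simp: beads_def word_def bead_def)

lemma diagram_iff: "(i, j) \<in> diagram l \<longleftrightarrow> 1 \<le> i \<and> 1 \<le> j \<and> j \<le> part l i"
  by (auto simp: diagram_def part_def)

lemma down_closed_eq_atLeastAtMost:
  fixes A :: "nat set"
  assumes "finite A" "0 \<notin> A" "\<And>i j. j \<in> A \<Longrightarrow> 1 \<le> i \<Longrightarrow> i \<le> j \<Longrightarrow> i \<in> A"
  shows "A = {1..card A}"
proof (cases "A = {}")
  case False
  have "A = {1..Max A}"
  proof (intro equalityI subsetI)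
    fix i assume "i \<in> A"
    then show "i \<in> {1..Max A}"
      using assms(1,2) by (cases i) auto
  next
    fix i assume "i \<in> {1..Max A}"
    then show "i \<in> A"
      using assms(3) Max_in[OF assms(1) False] by auto
  qed
  then show ?thesis
    by (metis card_atLeastAtMost diff_Suc_1 One_nat_def add_diff_cancel_right' Suc_eq_plus1)
qed simp

lemma sum_list_eq_card_diagram:
  "sum_list l = card (diagram l)"
proof -
  have "diagram l = Sigma {1..length l} (\<lambda>i. {1..part l i})"
    by (auto simp: diagram_def)
  then have "card (diagram l) = (\<Sum>i=1..length l. part l i)"
    by simp
  also have "\<dots> = (\<Sum>i=0..<length l. l ! i)"
    by (rule sum.reindex_bij_witness[of _ Suc "\<lambda>i. i - 1"]) (auto simp: part_def)
  finally show ?thesis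
    by (simp add: sum_list_sum_nth)
qed

locale self_conjugate =
  fixes l :: "nat list"
  assumes SC: "l \<in> SC"
begin

lemma partition: "is_partition l"
  using SC by (simp add: SC_def)

lemma bead_less: "1 \<le> i \<Longrightarrow> i < j \<Longrightarrow> bead l j < bead l i"
  using part_antimono[OF partition, of i j] by (simp add: bead_def)

lemma bead_less_iff: "1 \<le> i \<Longrightarrow> 1 \<le> j \<Longrightarrow> bead l j < bead l i \<longleftrightarrow> i < j"
  using bead_less[of i j] bead_less[of j i] by (cases i j rule: linorder_cases) auto

lemma bead_eq_iff: "1 \<le> i \<Longrightarrow> 1 \<le> j \<Longrightarrow> bead l i = bead l j \<longleftrightarrow> i = j"
  using bead_less[of i j] bead_less[of j i] by (cases i j rule: linorder_cases) auto

text \<open>Within the length this is an entry of \<open>conjugate l = l\<close>. Beyond it the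
  column is empty, because comparing lengths gives \<open>length l = part l 1\<close>.\<close>

lemma part_eq_card_column:
  assumes "1 \<le> j"
  shows "part l j = card {i. (i, j) \<in> diagram l}"
proof -
  have conj: "l = map (\<lambda>j. card {i. (i, j) \<in> diagram l}) [1..<part l 1 + 1]"
    using SC by (simp add: SC_def conjugate_def)
  then have len: "length l = part l 1"
    by (metis add_diff_cancel_right' length_map length_upt)
  show ?thesis
  proof (cases "j \<le> length l")
    case True
    then have "part l j = l ! (j - 1)"
      using assms by (simp add: part_def)
    also have "\<dots> = map (\<lambda>j. card {i. (i, j) \<in> diagram l}) [1..<part l 1 + 1] ! (j - 1)"
      using conj by simp
    also have "\<dots> = card {i. (i, [1..<part l 1 + 1] ! (j - 1)) \<in> diagram l}"
      using assms True len by (intro nth_map) simp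
    also have "[1..<part l 1 + 1] ! (j - 1) = j"
      using assms True len by (subst nth_upt) auto
    finally show ?thesis .
  next
    case False
    then have "part l i < j" if "1 \<le> i" for i
      using part_antimono[OF partition, of 1 i] that len by simp
    then have "{i. (i, j) \<in> diagram l} = {}"
      by (auto simp: diagram_iff not_le)
    then show ?thesis
      using False by (simp add: part_def)
  qed
qed

lemma column_eq:
  assumes "1 \<le> j"
  shows "{i. (i, j) \<in> diagram l} = {1..part l j}"
proof -
  have "{i. (i, j) \<in> diagram l} \<subseteq> {1..length l}"
    by (auto simp: diagram_def)
  then have "finite {i. (i, j) \<in> diagram l}"
    by (rule finite_subset) simp
  moreover have "(i, j) \<in> diagram l" if "(i', j) \<in> diagram l" "1 \<le> i" "i \<le> i'" for i i'
    using that part_antimono[OF partition, of i i'] by (auto simp: diagram_iff)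
  moreover have "(0, j) \<notin> diagram l"
    by (simp add: diagram_iff)
  ultimately show ?thesis
    using down_closed_eq_atLeastAtMost[of "{i. (i, j) \<in> diagram l}"] part_eq_card_column[OF assms]
    by simp
qed

lemma diagram_column_iff: "1 \<le> j \<Longrightarrow> (i, j) \<in> diagram l \<longleftrightarrow> 1 \<le> i \<and> i \<le> part l j"
  using column_eq[of j] by (simp add: set_eq_iff)

lemma diagram_sym: "(i, j) \<in> diagram l \<longleftrightarrow> (j, i) \<in> diagram l"
  using diagram_column_iff[of j i] by (auto simp: diagram_iff)

text \<open>By symmetry \<open>j \<le> part l i\<close> and \<open>i \<le> part l j\<close> hold or
  fail together. The sum is then at least 1 or at most -1, respectively.\<close>

lemma diagram_iff_bead:
  assumes "1 \<le> i" "1 \<le> j"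
  shows "(i, j) \<in> diagram l \<longleftrightarrow> 0 < bead l i + bead l j + 1" "bead l i + bead l j + 1 \<noteq> 0"
  using assms diagram_sym[of i j] by (auto simp: diagram_iff bead_def)

text \<open>The arm is \<open>part l i - j\<close>, the leg is \<open>part l j - i\<close> because
  column \<open>j\<close> is as long as row \<open>j\<close>, and the box itself adds 1.\<close>

lemma hook_eq:
  assumes "(i, j) \<in> diagram l"
  shows "int (hook l (i, j)) = bead l i + bead l j + 1"
proof -
  have ij: "1 \<le> i" "1 \<le> j" "j \<le> part l i" "i \<le> part l j"
    using assms diagram_sym[of i j] by (auto simp: diagram_iff)
  have "{(i', j'). (i', j') \<in> diagram l \<and> (i' = i \<and> j \<le> j' \<or> j' = j \<and> i \<le> i')}
    = Pair i ` {j..part l i} \<union> (\<lambda>i'. (i', j)) ` {i + 1..part l j}"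
    (is "?A = ?B")
  proof (intro equalityI subsetI)
    fix p assume "p \<in> ?A"
    then show "p \<in> ?B"
      using ij diagram_column_iff[of j] by (cases "fst p = i") (force simp: diagram_iff)+
  next
    fix p assume "p \<in> ?B"
    then consider j' where "p = (i, j')" "j \<le> j'" "j' \<le> part l i"
      | i' where "p = (i', j)" "i + 1 \<le> i'" "i' \<le> part l j"
      by auto
    then show "p \<in> ?A"
    proof cases
      case 1
      then show ?thesis
        using ij by (simp add: diagram_iff)
    next
      case 2
      then show ?thesis
        using diagram_column_iff[OF ij(2)] by simp
    qed
  qed
  moreover have "card (Pair i ` {j..part l i} \<union> (\<lambda>i'. (i', j)) ` {i + 1..part l j})
    = card (Pair i ` {j..part l i}) + card ((\<lambda>i'. (i', j)) ` {i + 1..part l j})"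
    by (rule card_Un_disjoint) auto
  ultimately have "hook l (i, j) = (part l i + 1 - j) + (part l j - i)"
    by (simp add: hook_def card_image inj_on_def)
  then show ?thesis
    using ij by (simp add: bead_def)
qed

text \<open>Two mutually reflected beads contradict \<open>diagram_iff_bead\<close>. Conversely a
  gap \<open>k\<close> with \<open>i\<close> beads above it is the horizontal step that ends column
  \<open>j = k + i + 1\<close>; this column has length \<open>i\<close>, so row \<open>j\<close> has
  bead \<open>i - j = -1 - k\<close>.\<close>

lemma beads_sym: "k \<in> beads l \<longleftrightarrow> -1 - k \<notin> beads l"
proof
  assume k: "k \<in> beads l"
  show "-1 - k \<notin> beads l"
  proof
    assume "-1 - k \<in> beads l"
    with k obtain i j where "1 \<le> i" "1 \<le> j" "k = bead l i" "-1 - k = bead l j"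
      by (auto simp: beads_eq)
    then show False
      using diagram_iff_bead(2)[of i j] by simp
  qed
next
  assume notin: "-1 - k \<notin> beads l"
  show "k \<in> beads l"
  proof (rule ccontr)
    assume k: "k \<notin> beads l"
    \<comment> \<open>The least such \<open>i\<close> is the number of beads above \<open>k\<close>;
      it may be 0, since \<open>Suc i\<close> is the row being tested.\<close>
    define P where "P i \<longleftrightarrow> bead l (Suc i) < k" for i
    have "P (length l + nat (-k))"
      by (auto simp: P_def bead_def part_def)
    define i where "i = (LEAST i. P i)"
    have i: "bead l (Suc i) < k"
      using LeastI[of P] \<open>P _\<close> unfolding i_def P_def by blast
    have above: "k < bead l i" if "1 \<le> i"
    proof -
      have "\<not> P (i - 1)"
        using not_less_Least[of "i - 1" P] that by (simp add: i_def)
      then show ?thesis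
        using that k by (force simp: P_def beads_eq)
    qed
    define j where "j = nat (k + int i + 1)"
    have j: "int j = k + int i + 1" "1 \<le> j"
      using i by (auto simp: j_def bead_def)
    have "(Suc i, j) \<notin> diagram l"
      using i j by (auto simp: diagram_iff bead_def)
    then have "part l j \<le> i"
      using diagram_column_iff[OF j(2)] by simp
    moreover have "(i, j) \<in> diagram l" if "1 \<le> i"
      using above[OF that] j that by (auto simp: diagram_iff bead_def)
    then have "i \<le> part l j"
      using diagram_column_iff[OF j(2)] by (cases "i = 0") auto
    ultimately have "part l j = i"
      by simp
    then have "bead l j = -1 - k"
      using j by (simp add: bead_def)
    then show False
      using notin j(2) by (force simp: beads_eq)
  qed
qed

lemma finite_beads_nonneg: "finite {k \<in> beads l. 0 \<le> k}"
  using word_balanced(2)[OF partition] by (simp add: beads_def conj_commute)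

text \<open>If \<open>k - 2 * int t\<close> is a gap, its reflection is a bead, and the box that it
  forms with \<open>k\<close> has hook length \<open>2 * t\<close>.\<close>

lemma sym_core_beads:
  assumes "is_core (2 * t) l" "1 \<le> t"
  shows "sym_core t (beads l)"
  unfolding sym_core_def
proof (intro conjI allI ballI)
  show "finite {k \<in> beads l. 0 \<le> k}" "\<And>k. k \<in> beads l \<longleftrightarrow> -1 - k \<notin> beads l"
    by (fact finite_beads_nonneg beads_sym)+
  fix k assume k: "k \<in> beads l"
  show "k - 2 * int t \<in> beads l"
  proof (rule ccontr)
    assume "k - 2 * int t \<notin> beads l"
    then have "-1 - (k - 2 * int t) \<in> beads l"
      using beads_sym by blast
    with k obtain i j where ij: "1 \<le> i" "1 \<le> j" "k = bead l i" "-1 - (k - 2 * int t) = bead l j"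
      by (auto simp: beads_eq)
    then have sum: "bead l i + bead l j + 1 = 2 * int t"
      by simp
    then have box: "(i, j) \<in> diagram l"
      using diagram_iff_bead(1) ij assms(2) by simp
    then have "hook l (i, j) = 2 * t"
      using hook_eq sum by fastforce
    then show False
      using assms(1) box by (auto simp: is_core_def)
  qed
qed

lemma bij_betw_diagram_pos_pairs:
  "bij_betw (\<lambda>(i, j). (bead l i, bead l j)) (diagram l) (pos_pairs (beads l))"
proof (rule bij_betwI')
  fix p q assume "p \<in> diagram l" "q \<in> diagram l"
  then show "((case p of (i, j) \<Rightarrow> (bead l i, bead l j)) = (case q of (i, j) \<Rightarrow> (bead l i, bead l j))) = (p = q)"
    using bead_eq_iff by (cases p; cases q) (simp add: diagram_iff)
next
  fix p assume "p \<in> diagram l"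
  then show "(case p of (i, j) \<Rightarrow> (bead l i, bead l j)) \<in> pos_pairs (beads l)"
    using diagram_iff_bead(1) by (cases p) (auto simp: pos_pairs_def beads_eq diagram_iff)
next
  fix q assume "q \<in> pos_pairs (beads l)"
  then obtain i j where "1 \<le> i" "1 \<le> j" "q = (bead l i, bead l j)" "0 < bead l i + bead l j + 1"
    by (auto simp: pos_pairs_def beads_eq)
  then show "\<exists>p\<in>diagram l. q = (case p of (i, j) \<Rightarrow> (bead l i, bead l j))"
    using diagram_iff_bead(1) by (intro bexI[of _ "(i, j)"]) auto
qed

lemma eps_eq:
  assumes "(i, j) \<in> diagram l"
  shows "eps (i, j) = (if bead l i < bead l j then -1 else 1)"
  using assms bead_less_iff[of j i] by (simp add: eps_def diagram_iff)

lemma card_pos_pairs_beads: "card (pos_pairs (beads l)) = sum_list l"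
  using bij_betw_same_card[OF bij_betw_diagram_pos_pairs] sum_list_eq_card_diagram by simp

lemma prod_hook_weight:
  "(\<Prod>s\<in>diagram l. \<tau> (int (hook l s) - eps s * (2 * int t)) / \<tau> (int (hook l s)))
    = (\<Prod>p\<in>pos_pairs (beads l). hook_weight t \<tau> p)"
  unfolding prod.reindex_bij_betw[OF bij_betw_diagram_pos_pairs, symmetric]
  by (rule prod.cong) (auto simp: hook_weight_def hook_eq eps_eq)

lemma pair_alpha_eq: "pair_alpha t (beads l) i = alpha (2 * t) l i"
proof -
  let ?h = "\<lambda>(i, j). (bead l i, bead l j)"
  let ?A = "{s \<in> diagram l. int (hook l s) = int (2 * t) - int i \<and> eps s = 1}"
  have "inj_on ?h ?A"
    by (rule inj_on_subset[OF bij_betw_imp_inj_on[OF bij_betw_diagram_pos_pairs]]) auto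
  moreover have "{(x, y) \<in> pos_pairs (beads l). x + y + 1 = 2 * int t - int i \<and> y \<le> x} = ?h ` ?A"
    unfolding bij_betw_imp_surj_on[OF bij_betw_diagram_pos_pairs, symmetric]
    by (force simp: hook_eq eps_eq split: if_splits)
  ultimately show ?thesis
    by (simp add: pair_alpha_def alpha_def card_image)
qed

end

section \<open>Runner tops and the V-coding\<close>

lemma sym_core_diff_multiple:
  assumes "sym_core t X" "k \<in> X"
  shows "k - 2 * int t * int n \<in> X"
proof (induction n)
  case (Suc n)
  then have "k - 2 * int t * int n - 2 * int t \<in> X"
    using assms(1) unfolding sym_core_def by blast
  then show ?case
    by (simp add: algebra_simps)
qed (use assms in simp)

text \<open>Beads are closed downwards in each residue class. If \<open>a > b\<close>, then
  \<open>b\<close> is at or below the bead \<open>a - 2 * int t\<close> and would be a bead.\<close>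

lemma sym_core_top_unique:
  assumes "sym_core t X" "a - 2 * int t \<in> X" "b \<notin> X" "a mod (2 * int t) = b mod (2 * int t)"
    "1 \<le> t"
  shows "a \<le> b"
proof (rule ccontr)
  assume "\<not> a \<le> b"
  define g where "g = 2 * int t"
  have "g dvd a - b"
    using assms(4) by (simp add: g_def mod_eq_dvd_iff)
  then obtain n where n: "a - b = g * n"
    by blast
  then have "1 \<le> n"
    using \<open>\<not> a \<le> b\<close> assms(5) by (smt (verit) g_def mult_nonneg_nonpos of_nat_0_le_iff)
  then have "a - g - g * int (nat (n - 1)) = b"
    using n by (simp add: algebra_simps)
  then show False
    using sym_core_diff_multiple[OF assms(1,2), of "nat (n - 1)"] assms(3) by (simp add: g_def)
qed

lemma sym_core_top_exists:
  assumes sc: "sym_core t X" and "1 \<le> t"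
  shows "\<exists>b. b mod (2 * int t) = c mod (2 * int t) \<and> b - 2 * int t \<in> X \<and> b \<notin> X"
proof -
  have fin: "finite {x \<in> X. 0 \<le> x}"
    using sc unfolding sym_core_def by blast
  define K where "K = Max {x \<in> X. 0 \<le> x}"
  have K: "x \<le> K" if "x \<in> X" "0 \<le> x" for x
    unfolding K_def by (rule Max_ge[OF fin]) (use that in simp)
  \<comment> \<open>With this bound, \<open>c - 2 * int t * K'\<close> is a bead and
    \<open>c + 2 * int t * K'\<close> a gap. Using \<open>max 0 K\<close> covers the case without
    nonnegative beads, where \<open>K\<close> is an arbitrary value.\<close>
  define K' where "K' = max 0 K + \<bar>c\<bar> + 2"
  have "0 \<le> K'"
    by (simp add: K'_def)
  have large: "x \<notin> X" if "K' - \<bar>c\<bar> - 1 \<le> x" for x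
    using K[of x] that by (auto simp: K'_def max_def split: if_splits)
  let ?f = "\<lambda>n. c - 2 * int t * K' + 2 * int t * int n"
  have K't: "K' \<le> 2 * int t * K'"
    using assms(2) \<open>0 \<le> K'\<close> mult_right_mono[of 1 "2 * int t" K'] by simp
  have start: "?f 0 \<in> X"
  proof -
    have "-1 - ?f 0 \<notin> X"
      using K't by (intro large) simp
    then show ?thesis
      using sc unfolding sym_core_def by blast
  qed
  have "?f (nat (2 * K')) = c + 2 * int t * K'"
    using \<open>0 \<le> K'\<close> by simp
  also have "\<dots> \<notin> X"
    using K't by (intro large) linarith
  finally have "?f (nat (2 * K')) \<notin> X" .
  then have "\<exists>n. ?f n \<notin> X"
    by blast
  \<comment> \<open>The first gap met when climbing the class is the top.\<close>
  then obtain n where n: "?f n \<notin> X" "\<And>m. m < n \<Longrightarrow> ?f m \<in> X"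
    using exists_least_iff[of "\<lambda>n. ?f n \<notin> X"] by blast
  then obtain m where m: "n = Suc m"
    using start by (cases n) auto
  have "?f n = c + 2 * int t * (int n - K')"
    by (simp add: algebra_simps)
  then have "?f n mod (2 * int t) = c mod (2 * int t)"
    by (metis mod_mult_self2)
  moreover have "?f n - 2 * int t = ?f m"
    by (simp add: m algebra_simps)
  then have "?f n - 2 * int t \<in> X"
    using n(2)[of m] m by (simp only: lessI)
  ultimately show ?thesis
    using n(1) by blast
qed

text \<open>The maximum ranges over the numbers one step above a bead of the class;
  \<open>sym_core_top_unique\<close> bounds each of them by the gap \<open>b\<close>.\<close>

lemma beta_eq:
  assumes "sym_core t (beads l)" "1 \<le> t"
    and b: "b - 2 * int t \<in> beads l" "b \<notin> beads l" "b mod (2 * int t) = int i"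
  shows "beta (2 * t) l i = b"
  unfolding beta_def
proof (rule Greatest_equality)
  have "b = (b div (2 * int t) - 1 + 1) * int (2 * t) + int i"
    using b(3) by (simp add: minus_mod_eq_div_mult [symmetric])
  moreover from this have "(b div (2 * int t) - 1) * int (2 * t) + int i = b - 2 * int t"
    by (simp add: algebra_simps)
  ultimately show "\<exists>k. b = (k + 1) * int (2 * t) + int i \<and> word l (k * int (2 * t) + int i) = 0"
    using b(1) by (intro exI[of _ "b div (2 * int t) - 1"]) (simp add: beads_def)
next
  fix a assume "\<exists>k. a = (k + 1) * int (2 * t) + int i \<and> word l (k * int (2 * t) + int i) = 0"
  then obtain k where k: "a = (k + 1) * (2 * int t) + int i" "a - 2 * int t \<in> beads l"
    by (auto simp: beads_def algebra_simps)
  then have "a mod (2 * int t) = b mod (2 * int t)"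
    unfolding k(1) mod_mult_self3 b(3)[symmetric] by simp
  then show "a \<le> b"
    using sym_core_top_unique[OF assms(1) k(2) b(2) _ assms(2)] by blast
qed

lemma bij_betw_beta:
  assumes sc: "sym_core t (beads l)" and t: "1 \<le> t"
  shows "bij_betw (beta (2 * t) l) {0..<2 * t} {b. b - 2 * int t \<in> beads l \<and> b \<notin> beads l}"
proof (rule bij_betw_byWitness[where f' = "\<lambda>b. nat (b mod (2 * int t))"])
  let ?B = "{b. b - 2 * int t \<in> beads l \<and> b \<notin> beads l}"
  have beta: "\<exists>b\<in>?B. beta (2 * t) l i = b \<and> b mod (2 * int t) = int i" if "i \<in> {0..<2 * t}" for i
  proof -
    have "int i mod (2 * int t) = int i"
      using that by simp
    then obtain b where "b \<in> ?B" "b mod (2 * int t) = int i"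
      using sym_core_top_exists[OF sc t, of "int i"] by auto
    then show ?thesis
      using beta_eq[OF sc t] by auto
  qed
  show "beta (2 * t) l ` {0..<2 * t} \<subseteq> ?B"
    using beta by blast
  show "\<forall>i\<in>{0..<2 * t}. nat (beta (2 * t) l i mod (2 * int t)) = i"
    using beta by force
  show "(\<lambda>b. nat (b mod (2 * int t))) ` ?B \<subseteq> {0..<2 * t}"
    using t by (auto simp: nat_less_iff)
  show "\<forall>b\<in>?B. beta (2 * t) l (nat (b mod (2 * int t))) = b"
    using t by (auto intro!: beta_eq[OF sc t])
qed

text \<open>The reflection \<open>b -> 2 * int t - 1 - b\<close> permutes the \<open>2 * t\<close>
  runner tops and exchanges those below \<open>int t\<close> with the others. So exactly
  \<open>t\<close> of them are at least \<open>int t\<close>, and these are the largest. Subtracting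
  \<open>int t\<close> turns \<open>v\<^sub>i\<close> into \<open>r\<^sub>i - 1/2\<close>.\<close>

lemma V_coding_eq:
  assumes sc: "sym_core t (beads l)" and t: "1 \<le> t"
  shows "V_coding (2 * t) t l = rev (sorted_list_of_set ((\<lambda>b. b + int t) ` tops t (beads l)))"
    and "card (tops t (beads l)) = t"
proof -
  let ?X = "beads l"
  define B where "B = {b. b - 2 * int t \<in> ?X \<and> b \<notin> ?X}"
  let ?P = "{b \<in> B. int t \<le> b}" and ?N = "{b \<in> B. b < int t}"
  have beta: "beta (2 * t) l ` {0..<2 * t} = B"
    unfolding B_def using bij_betw_beta[OF sc t] by (rule bij_betw_imp_surj_on)
  have cardB: "card B = 2 * t"
    using bij_betw_same_card[OF bij_betw_beta[OF sc t]] by (simp add: B_def)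
  have finB: "finite B"
    using beta by (metis finite_imageI finite_atLeastLessThan)
  have P: "?P = (\<lambda>b. b + int t) ` tops t ?X"
  proof (intro equalityI subsetI)
    fix b assume "b \<in> ?P"
    then have "b - int t \<in> tops t ?X"
      by (auto simp: tops_def B_def)
    then show "b \<in> (\<lambda>b. b + int t) ` tops t ?X"
      by (rule rev_image_eqI) simp
  qed (auto simp: tops_def B_def)
  have refl: "2 * int t - 1 - b \<in> B \<longleftrightarrow> b \<in> B" for b
  proof -
    have "-1 - b \<in> ?X \<longleftrightarrow> b \<notin> ?X" "-1 - (b - 2 * int t) \<in> ?X \<longleftrightarrow> b - 2 * int t \<notin> ?X"
      using sc unfolding sym_core_def by blast+
    then show ?thesis
      by (auto simp: B_def algebra_simps)
  qed
  have "bij_betw (\<lambda>b. 2 * int t - 1 - b) ?N ?P"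
    by (rule bij_betw_byWitness[where f' = "\<lambda>b. 2 * int t - 1 - b"]) (auto simp: refl)
  then have "card ?N = card ?P"
    by (rule bij_betw_same_card)
  moreover have "card (?N \<union> ?P) = card ?N + card ?P"
    by (rule card_Un_disjoint) (use finB in auto)
  moreover have "?N \<union> ?P = B"
    by auto
  ultimately have cardP: "card ?P = t"
    using cardB by simp
  then show "card (tops t ?X) = t"
    unfolding P by (simp add: card_image inj_on_def)
  have "sorted_list_of_set B = sorted_list_of_set ?N @ sorted_list_of_set ?P"
  proof (rule sorted_list_of_set_unique[THEN iffD1, OF finB])
    show "sorted_wrt (<) (sorted_list_of_set ?N @ sorted_list_of_set ?P) \<and>
      set (sorted_list_of_set ?N @ sorted_list_of_set ?P) = B \<and>
      length (sorted_list_of_set ?N @ sorted_list_of_set ?P) = card B"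
      using finB cardB cardP \<open>card ?N = card ?P\<close> by (auto simp: sorted_wrt_append)
  qed
  then have "V_coding (2 * t) t l = take t (rev (sorted_list_of_set ?P) @ rev (sorted_list_of_set ?N))"
    by (simp add: V_coding_def beta)
  also have "\<dots> = rev (sorted_list_of_set ?P)"
    using cardP by simp
  finally show "V_coding (2 * t) t l = rev (sorted_list_of_set ((\<lambda>b. b + int t) ` tops t ?X))"
    unfolding P .
qed

lemma V_coding_enumerates_tops:
  assumes sc: "sym_core t (beads l)" and t: "1 \<le> t"
  defines "s \<equiv> \<lambda>i. V_coding (2 * t) t l ! (i - 1) - int t"
  shows "s ` {1..t} = tops t (beads l)"
    and "\<And>i j. 1 \<le> i \<Longrightarrow> i < j \<Longrightarrow> j \<le> t \<Longrightarrow> s j < s i"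
proof -
  let ?S = "(\<lambda>b. b + int t) ` tops t (beads l)"
  let ?xs = "sorted_list_of_set ?S"
  have fin: "finite ?S"
    using V_coding_eq(2)[OF sc t] t by (metis card.infinite finite_imageI not_one_le_zero)
  have len: "length ?xs = t"
    using V_coding_eq(2)[OF sc t] by (simp add: card_image inj_on_def)
  have V: "V_coding (2 * t) t l = rev ?xs"
    by (rule V_coding_eq[OF sc t])
  have "s ` {1..t} = (\<lambda>b. b - int t) ` ((\<lambda>i. rev ?xs ! i) ` {0..<t})"
  proof -
    have "{0..<t} = (\<lambda>i. i - 1) ` {1..t}"
      by (auto intro!: image_eqI[of _ _ "Suc _"])
    then show ?thesis
      by (simp add: image_image s_def V)
  qed
  also have "(\<lambda>i. rev ?xs ! i) ` {0..<t} = set (rev ?xs)"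
    using nth_image[of t "rev ?xs"] len by simp
  also have "\<dots> = ?S"
    using fin by simp
  finally show "s ` {1..t} = tops t (beads l)"
    by (simp add: image_image)
  fix i j assume ij: "1 \<le> i" "i < j" "j \<le> t"
  have "?xs ! (t - j) < ?xs ! (t - i)"
    by (rule sorted_wrt_nth_less[OF strict_sorted_list_of_set]) (use ij len in auto)
  then show "s j < s i"
    using ij len by (simp add: s_def V rev_nth)
qed

section \<open>Transfer to the V-coding\<close>

theorem theorem4p23:
  fixes t g :: nat and \<omega> :: "nat list" and v :: "int list" and r :: "nat \<Rightarrow> rat"
  assumes "t \<ge> 1" and "g = 2 * t"
    and "\<omega> \<in> SC_core g"
    and "v = V_coding g t \<omega>"
    and "\<And>i. i \<in> {1..t} \<Longrightarrow> r i = of_int (v ! (i - 1)) - of_nat g / 2 + 1 / 2"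
  shows "of_nat (sum_list \<omega>) = 1 / of_nat g * (\<Sum>i=1..t. (r i)\<^sup>2) - ((of_nat g)\<^sup>2 - 1) / 24
    \<and> (\<forall>\<tau> :: int \<Rightarrow> 'a::field. (\<forall>k. \<tau> k \<noteq> 0) \<longrightarrow>
        (\<Prod>s\<in>diagram \<omega>. \<tau> (int (hook \<omega> s) - eps s * int g) / \<tau> (int (hook \<omega> s)))
        = (\<Prod>i=1..g-1. (\<tau> (- int i) / \<tau> (int i)) ^ alpha g \<omega> i)
          * (\<Prod>(i, j)\<in>{(i, j). 1 \<le> i \<and> i < j \<and> j \<le> t}.
              \<tau> \<lfloor>r i - r j\<rfloor> / \<tau> (int j - int i)
              * (\<tau> \<lfloor>r i + r j\<rfloor> / \<tau> (int g + 1 - int i - int j))))"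
proof -
  interpret self_conjugate \<omega>
    using assms(3) by unfold_locales (simp add: SC_core_def)
  let ?X = "beads \<omega>"
  let ?P = "{(i, j). 1 \<le> i \<and> i < j \<and> j \<le> t}"
  have sc: "sym_core t ?X"
    using assms(1-3) by (intro sym_core_beads) (auto simp: SC_core_def)
  define s where "s = (\<lambda>i. v ! (i - 1) - int t)"
  have enum: "s ` {1..t} = tops t ?X" "\<And>i j. 1 \<le> i \<Longrightarrow> i < j \<Longrightarrow> j \<le> t \<Longrightarrow> s j < s i"
    unfolding s_def assms(2,4) using V_coding_enumerates_tops[OF sc assms(1)] .
  have r: "r i = of_int (s i) + 1 / 2" if "i \<in> {1..t}" for i
    using assms(5)[OF that] assms(2) by (simp add: s_def)
  have "inj_on s {1..t}"
  proof (rule linorder_inj_onI)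
    show "s i \<noteq> s j" if "i < j" "i \<in> {1..t}" "j \<in> {1..t}" for i j
      using enum(2)[of i j] that by simp
  qed auto
  then have "(\<Sum>i=1..t. (r i)\<^sup>2) = (\<Sum>b\<in>tops t ?X. (of_int b + 1 / 2)\<^sup>2)"
    unfolding enum(1)[symmetric] by (subst sum.reindex) (auto simp: r)
  moreover have "2 * of_nat t * of_nat (sum_list \<omega>)
      = (\<Sum>b\<in>tops t ?X. (of_int b + 1 / 2 :: rat)\<^sup>2) - of_nat t * (4 * (of_nat t)\<^sup>2 - 1) / 12"
    unfolding card_pos_pairs_beads[symmetric] using sym_core_formulas[OF assms(1) sc] by blast
  ultimately have size: "of_nat (sum_list \<omega>)
      = 1 / of_nat g * (\<Sum>i=1..t. (r i)\<^sup>2) - ((of_nat g)\<^sup>2 - 1) / 24"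
    using assms(1,2) by (simp add: field_simps power2_eq_square)
  have "(\<Prod>s\<in>diagram \<omega>. \<tau> (int (hook \<omega> s) - eps s * int g) / \<tau> (int (hook \<omega> s)))
        = (\<Prod>i=1..g-1. (\<tau> (- int i) / \<tau> (int i)) ^ alpha g \<omega> i)
          * (\<Prod>(i, j)\<in>?P. \<tau> \<lfloor>r i - r j\<rfloor> / \<tau> (int j - int i)
              * (\<tau> \<lfloor>r i + r j\<rfloor> / \<tau> (int g + 1 - int i - int j)))"
    if nz: "\<forall>k. \<tau> k \<noteq> 0" for \<tau> :: "int \<Rightarrow> 'a"
  proof -
    have num: "diff_sum_prod \<tau> (tops t ?X)
        = (\<Prod>(i, j)\<in>?P. \<tau> (s i - s j) * \<tau> (s i + s j + 1))"
      by (rule diff_sum_prod_enum[OF enum])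
    \<comment> \<open>The tops \<open>int t - int i\<close> of the empty partition produce the
      denominator arguments \<open>j - i\<close> and \<open>g + 1 - i - j\<close>.\<close>
    have "(\<lambda>i. int t - int i) ` {1..t} = {0..<int t}"
    proof (intro equalityI subsetI)
      fix b assume "b \<in> {0..<int t}"
      then show "b \<in> (\<lambda>i. int t - int i) ` {1..t}"
        by (intro image_eqI[of _ _ "nat (int t - b)"]) auto
    qed auto
    then have den: "diff_sum_prod \<tau> {0..<int t}
        = (\<Prod>(i, j)\<in>?P. \<tau> ((int t - int i) - (int t - int j)) * \<tau> ((int t - int i) + (int t - int j) + 1))"
      by (rule diff_sum_prod_enum) auto
    have floors: "\<lfloor>r i - r j\<rfloor> = s i - s j \<and> \<lfloor>r i + r j\<rfloor> = s i + s j + 1" if "(i, j) \<in> ?P" for i j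
    proof -
      have "r i - r j = of_int (s i - s j)" "r i + r j = of_int (s i + s j + 1)"
        using that by (auto simp: r)
      then show ?thesis
        by (simp only: floor_of_int)
    qed
    have ratio: "(\<Prod>(i, j)\<in>?P. \<tau> \<lfloor>r i - r j\<rfloor> / \<tau> (int j - int i)
              * (\<tau> \<lfloor>r i + r j\<rfloor> / \<tau> (int g + 1 - int i - int j)))
      = diff_sum_prod \<tau> (tops t ?X) / diff_sum_prod \<tau> {0..<int t}"
      unfolding num den prod_dividef[symmetric]
    proof (rule prod.cong[OF refl], clarify)
      fix i j assume "1 \<le> i" "i < j" "j \<le> t"
      then have "\<lfloor>r i - r j\<rfloor> = s i - s j" "\<lfloor>r i + r j\<rfloor> = s i + s j + 1"
        using floors by auto
      moreover have "int j - int i = (int t - int i) - (int t - int j)"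
          "int g + 1 - int i - int j = (int t - int i) + (int t - int j) + 1"
        using assms(2) by auto
      ultimately show "\<tau> \<lfloor>r i - r j\<rfloor> / \<tau> (int j - int i)
          * (\<tau> \<lfloor>r i + r j\<rfloor> / \<tau> (int g + 1 - int i - int j))
        = \<tau> (s i - s j) * \<tau> (s i + s j + 1)
          / (\<tau> ((int t - int i) - (int t - int j)) * \<tau> ((int t - int i) + (int t - int j) + 1))"
        by (metis times_divide_times_eq)
    qed
    have "(\<Prod>p\<in>pos_pairs ?X. hook_weight t \<tau> p) * diff_sum_prod \<tau> {0..<int t}
      = (\<Prod>i=1..2 * t - 1. (\<tau> (- int i) / \<tau> (int i)) ^ pair_alpha t ?X i) * diff_sum_prod \<tau> (tops t ?X)"
      using sym_core_formulas[OF assms(1) sc] nz by blast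
    moreover have "diff_sum_prod \<tau> {0..<int t} \<noteq> 0"
      using nz by (intro diff_sum_prod_nonzero) auto
    ultimately have "(\<Prod>p\<in>pos_pairs ?X. hook_weight t \<tau> p)
      = (\<Prod>i=1..2 * t - 1. (\<tau> (- int i) / \<tau> (int i)) ^ pair_alpha t ?X i)
        * (diff_sum_prod \<tau> (tops t ?X) / diff_sum_prod \<tau> {0..<int t})"
      by (simp add: eq_divide_eq)
    then show ?thesis
      unfolding ratio using prod_hook_weight[of \<tau> t] assms(2) by (simp add: pair_alpha_eq)
  qed
  with size show ?thesis
    by blast
qed

end
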